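(* Let $D$ be a reduced connected oriented link diagram with canonical Euler characteristic $\chi(D)\le 0$. Then the number $t(D)$ of $\sim$-equivalence classes of crossings of $D$ satisfies $$t(D)\le\begin{cases}-3\chi(D) & \text{if }\chi(D)<0,\\ 1 & \text{if }\chi(D)=0.\end{cases}$$ If moreover $D$ is $\bar t_2'$-irreducible and has $n(D)$ link components, then the number $c(D)$ of crossings of $D$ satisfies $$c(D)\le\begin{cases}4 & \text{if }\chi(D)=-1\text{ and }n(D)=1,\\ 2 & \text{if }\chi(D)=0,\\ -6\chi(D) & \text{if }\chi(D)<0\text{ and }n(D)=2-\chi(D),\\ -5\chi(D)+n(D)-3 & \text{otherwise.}\end{cases}$$
   Context: A diagram is reduced if it has no nugatory crossing, and connected if its underlying plane curve is connected. The canonical Euler characteristic of a diagram $D$ is $\chi(D)=s(D)-c(D)$, where $s(D)$ is the number of Seifert circles and $c(D)$ the number of crossings. A flype is the move on a diagram in which a crossing $p$ joined to two of the ends on one side of a tangle $P$ is moved to the two ends on the opposite side of $P$, while $P$ is rotated by $180^\circ$ about the corresponding axis. Over/under information is irrelevant for the following notions. Two crossings of $D$ are called $\sim$-equivalent if they coincide or if after a sequence of flypes they can be made to form a reverse clasp, i.e. a clasp (two crossings bounding a bigon) whose two strands are oppositely oriented. This is an equivalence relation. (Equivalently: at each crossing exactly two of the four adjacent regions of the diagram contain parts of the Seifert circles near the crossing; call the two others the non-Seifert circle regions of the crossing. Two crossings are $\sim$-equivalent iff they have the same pair of non-Seifert circle regions.) A $\bar t_2'$ twist at a crossing replaces it by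 three crossings in a row forming two reverse clasps, all with the same sign as the original crossing (so it adds two crossings $\sim$-equivalent to the given one). A diagram is $\bar t_2'$-irreducible (generating) if it cannot be reduced by flypes and inverses of $\bar t_2'$ twists, i.e. if every $\sim$-equivalence class has at most two crossings. *)

theory Defs
  imports Main "HOL-Combinatorics.Orbits"
begin

text \<open>
  Oriented link diagrams, up to isotopy, are given by signed Gauss codes. A link passes each
  crossing twice, once along the overcrossing and once along the undercrossing strand.
  Following the orientation from one passage to the next one gives a permutation of the passages;
  together with the signs of the crossings it determines the diagram on the sphere (up to the
  relative position of the pieces if the diagram is disconnected).
\<close>

datatype strand = Over | Under

fun other :: "strand \<Rightarrow> strand" where
  "other Over = Under"
| "other Under = Over"

type_synonym 'c passage = "'c \<times> strand"

text \<open>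
  The last field counts the components of the link that are drawn without any crossing, as simple
  closed curves disjoint from the rest; the Gauss code does not see them.
\<close>

record 'c diagram =
  crossings :: "'c set"
  positive :: "'c \<Rightarrow> bool"
  next_passage :: "'c passage \<Rightarrow> 'c passage"
  simple_circles :: nat

definition passages :: "'c diagram \<Rightarrow> 'c passage set" where
  "passages D = crossings D \<times> UNIV"

text \<open>
  The edges of the plane curve are the arcs from a passage to the next one. Every passage has two
  ends at its crossing: the edge along which it is entered and the edge along which it is left.
\<close>

datatype direction = Incoming | Outgoing

fun opposite :: "direction \<Rightarrow> direction" where
  "opposite Incoming = Outgoing"
| "opposite Outgoing = Incoming"

type_synonym 'c endpoint = "'c passage \<times> direction"

definition ends_at :: "'c \<Rightarrow> 'c endpoint set" where
  "ends_at c = ({c} \<times> UNIV) \<times> UNIV"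

definition ends :: "'c diagram \<Rightarrow> 'c endpoint set" where
  "ends D = passages D \<times> UNIV"

fun across :: "'c diagram \<Rightarrow> 'c endpoint \<Rightarrow> 'c endpoint" where
  "across D (p, Outgoing) = (next_passage D p, Incoming)"
| "across D (p, Incoming) = (inv (next_passage D) p, Outgoing)"

text \<open>
  Draw a crossing with both strands pointing upwards. At a positive crossing the
  overcrossing strand runs from bottom left to top right, at a negative crossing the undercrossing
  one does. The function \<open>rot\<close> sends an end at a crossing to the next one in
  counterclockwise order.
\<close>

definition rightward :: "'c diagram \<Rightarrow> 'c \<Rightarrow> strand" where
  "rightward D c = (if positive D c then Over else Under)"

fun rot :: "'c diagram \<Rightarrow> 'c endpoint \<Rightarrow> 'c endpoint" where
  "rot D ((c, s), d) = ((c, other s), if s = rightward D c then d else opposite d)"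

text \<open>
  A corner is an angle between two consecutive ends at a crossing. The end \<open>h\<close> also
  stands for the corner between \<open>h\<close> and \<open>rot D h\<close>. Going along the boundary of a
  region one gets from the corner \<open>h\<close> to the corner \<open>across D (rot D h)\<close>, so the
  regions are the orbits of this map, i.e. they are represented by their sets of corners.
\<close>

definition region :: "'c diagram \<Rightarrow> 'c endpoint \<Rightarrow> 'c endpoint set" where
  "region D h = orbit (across D \<circ> rot D) h"

definition regions :: "'c diagram \<Rightarrow> 'c endpoint set set" where
  "regions D = region D ` ends D"

definition adjacent_crossings :: "'c diagram \<Rightarrow> ('c \<times> 'c) set" where
  "adjacent_crossings D = {(fst p, fst (next_passage D p)) | p. p \<in> passages D}"

text \<open>The connected components of the part of the plane curve that has crossings.\<close>

definition pieces :: "'c diagram \<Rightarrow> 'c set set" where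
  "pieces D = crossings D //
     {(c, c'). c \<in> crossings D \<and> c' \<in> crossings D \<and>
        (c, c') \<in> (adjacent_crossings D \<union> (adjacent_crossings D)\<inverse>)\<^sup>*}"

text \<open>
  The last condition singles out the Gauss codes of plane (classical) diagrams among those of
  virtual diagrams: \<open>regions\<close> treats each piece separately, so it says that every piece with
  its \<open>c\<close> crossings and \<open>2c\<close> edges has Euler characteristic 2 (for each piece, 2 is the largest
  possible value).
\<close>

definition link_diagram :: "'c diagram \<Rightarrow> bool" where
  "link_diagram D \<longleftrightarrow>
     finite (crossings D) \<and>
     next_passage D permutes passages D \<and>
     int (card (crossings D)) - int (2 * card (crossings D)) + int (card (regions D))
       = 2 * int (card (pieces D))"

definition connected_diagram :: "'c diagram \<Rightarrow> bool" where
  "connected_diagram D \<longleftrightarrow> card (pieces D) + simple_circles D = 1"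

text \<open>
  A crossing is nugatory if some closed curve in the plane meets the diagram only in this crossing
  and there transversely to both strands, i.e. if two opposite corners lie in the same region.
\<close>

definition nugatory :: "'c diagram \<Rightarrow> 'c \<Rightarrow> bool" where
  "nugatory D c \<longleftrightarrow> (\<exists>h\<in>ends_at c. region D h = region D (rot D (rot D h)))"

definition reduced :: "'c diagram \<Rightarrow> bool" where
  "reduced D \<longleftrightarrow> (\<forall>c\<in>crossings D. \<not> nugatory D c)"

definition crossing_number :: "'c diagram \<Rightarrow> nat" where
  "crossing_number D = card (crossings D)"

definition num_components :: "'c diagram \<Rightarrow> nat" where
  "num_components D = card (orbit (next_passage D) ` passages D) + simple_circles D"

text \<open>
  A Seifert circle that enters a crossing along one strand leaves it along the other one.
\<close>

definition seifert_next :: "'c diagram \<Rightarrow> 'c passage \<Rightarrow> 'c passage" where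
  "seifert_next D = (\<lambda>(c, s). next_passage D (c, other s))"

definition num_seifert_circles :: "'c diagram \<Rightarrow> nat" where
  "num_seifert_circles D = card (orbit (seifert_next D) ` passages D) + simple_circles D"

definition canonical_euler_char :: "'c diagram \<Rightarrow> int" where
  "canonical_euler_char D = int (num_seifert_circles D) - int (crossing_number D)"

text \<open>
  Near a crossing the Seifert circles turn from an incoming to a neighbouring outgoing end, cutting
  the corner between them. The two corners which they avoid are those between the two outgoing
  and between the two incoming ends.
\<close>

definition non_seifert_regions :: "'c diagram \<Rightarrow> 'c \<Rightarrow> 'c endpoint set set" where
  "non_seifert_regions D c = {region D h | h. h \<in> ends_at c \<and> snd h = snd (rot D h)}"

text \<open>
  The relation \<open>\<sim>\<close> on crossings. Two crossings have the same pair of non-Seifert circle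
  regions if and only if they coincide or can be made by flypes to form a reverse clasp.
\<close>

definition twist_equiv :: "'c diagram \<Rightarrow> ('c \<times> 'c) set" where
  "twist_equiv D = {(c, c'). c \<in> crossings D \<and> c' \<in> crossings D \<and>
     non_seifert_regions D c = non_seifert_regions D c'}"

definition twist_classes :: "'c diagram \<Rightarrow> 'c set set" where
  "twist_classes D = crossings D // twist_equiv D"

definition num_twist_classes :: "'c diagram \<Rightarrow> nat" where
  "num_twist_classes D = card (twist_classes D)"

definition t2_irreducible :: "'c diagram \<Rightarrow> bool" where
  "t2_irreducible D \<longleftrightarrow> (\<forall>K\<in>twist_classes D. card K \<le> 2)"

end

theory Submission
  imports Defs
begin

text \<open>
  Write \<open>c\<close>, \<open>s\<close>, \<open>n\<close> for the numbers of crossings, Seifert circles and components and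
  \<open>\<chi> = s - c\<close>. Every crossing lies on one side of each of the two Seifert circles through it. Let
  \<open>J\<close> be the number of separating Seifert circles, those with crossings on both sides. Then there are
  \<open>s + J\<close> nonempty sides, of total degree \<open>2 c\<close>; reducedness makes every degree at least 2, and
  a side of degree 2 (a bigon) consists of two equivalent crossings. A class with \<open>k\<close> crossings
  has at most \<open>k - 1\<close> bigons, or \<open>k\<close> if it is full, i.e. all its crossings lie on bigons only. A
  full class is a union of components of the graph of crossings and sides; there are at most
  \<open>J + 1\<close> of these components, as the diagram is connected. Counting degrees now bounds the number of
  classes.

  For the number of crossings of an irreducible diagram one needs a lower bound for \<open>n\<close>, which is
  obtained by linear algebra over the field with two elements. Unions of regions which contain an
  even number of corners at each crossing are bounded by components, so that there are at most
  \<open>2 ^ (n + 1)\<close> of them. As there are \<open>c + 2\<close> regions, duality gives at most \<open>2 ^ (n - 1)\<close> balanced sets of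
  crossings, those with an even number of corners in each region. Each set \<open>y\<close> of non-Seifert
  circle regions has a boundary, the set of crossings at which exactly one of the two non-Seifert
  circle regions belongs to \<open>y\<close>. This is balanced as soon as it avoids the single crossings (classes of
  size 1) and the separating circles. The number of these constraints thus bounds
  \<open>2 - \<chi> - n\<close>, and single crossings and large sides of separating circles have to be
  paid for in the count of degrees.
\<close>


section \<open>Orbits, parity and binary linear algebra\<close>

lemma orbit_subset_of_closed:
  assumes "f ` A \<subseteq> A" and "x \<in> A"
  shows "orbit f x \<subseteq> A"
proof
  fix y assume "y \<in> orbit f x"
  then show "y \<in> A" using assms by induction auto
qed

text \<open>\<open>orbit f x\<close> starts at \<open>f x\<close>, so \<open>x\<close> must be shown
  to recur: \<open>f\<close> is injective on the finite orbit, hence onto it, and the preimage of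
  \<open>f x\<close> found there can only be \<open>x\<close>.\<close>

lemma orbit_self:
  assumes "finite A" and "bij_betw f A A" and "x \<in> A"
  shows "x \<in> orbit f x"
proof -
  have sub: "orbit f x \<subseteq> A"
    using assms by (intro orbit_subset_of_closed) (auto simp: bij_betw_def)
  have inj: "inj_on f A" using assms by (simp add: bij_betw_def)
  have "f ` orbit f x \<subseteq> orbit f x" by (auto intro: orbit.step)
  then have "f ` orbit f x = orbit f x"
    using inj sub by (meson assms(1) endo_inj_surj finite_subset inj_on_subset)
  then obtain z where "z \<in> orbit f x" "f z = f x"
    by (metis orbit.base imageE)
  then show ?thesis using inj sub assms(3) by (metis inj_onD subsetD)
qed

lemma orbit_eq:
  assumes "finite A" and "bij_betw f A A" and "x \<in> A" and "y \<in> orbit f x"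
  shows "orbit f y = orbit f x"
  using orbit_self[OF assms(1-3)] assms(4) by (meson orbit_swap orbit_trans subsetI subset_antisym)

lemma bij_betw_orbit:
  assumes "finite A" and "bij_betw f A A" and "x \<in> A"
  shows "bij_betw f (orbit f x) (orbit f x)"
proof -
  have sub: "orbit f x \<subseteq> A"
    using assms by (intro orbit_subset_of_closed) (auto simp: bij_betw_def)
  have inj: "inj_on f (orbit f x)" using assms sub by (meson bij_betw_def inj_on_subset)
  have "f ` orbit f x \<subseteq> orbit f x" by (auto intro: orbit.step)
  then have "f ` orbit f x = orbit f x"
    using inj sub by (meson assms(1) endo_inj_surj finite_subset)
  then show ?thesis using inj by (simp add: bij_betw_def)
qed

lemma orbit_invariant:
  assumes "f ` A \<subseteq> A" and "x \<in> A" and "\<And>z. z \<in> A \<Longrightarrow> g (f z) = g z" and "y \<in> orbit f x"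
  shows "g y = g x"
proof -
  have sub: "orbit f x \<subseteq> A" using assms(1,2) by (rule orbit_subset_of_closed)
  from assms(4) show ?thesis
    by induction (use assms sub in auto)
qed

text \<open>Around each cycle of the permutation a two-valued function returns to its initial value,
  so it flips evenly often. This yields the parity of cuts, on a single side and as a whole.\<close>

lemma even_card_changes:
  fixes g :: "'a \<Rightarrow> bool"
  assumes "finite X" and "bij_betw f X X"
  shows "even (card {x \<in> X. g (f x) \<noteq> g x})"
proof -
  let ?n = "\<lambda>x. of_bool (g x) :: nat"
  have "(\<Sum>x\<in>X. ?n (f x)) = (\<Sum>x\<in>X. ?n x)"
    using assms(2) by (rule sum.reindex_bij_betw)
  then have "(\<Sum>x\<in>X. ?n (f x) + ?n x) = 2 * (\<Sum>x\<in>X. ?n x)"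
    by (simp add: sum.distrib)
  then have "even (\<Sum>x\<in>X. ?n (f x) + ?n x)" by simp
  moreover have "{x \<in> X. odd (?n (f x) + ?n x)} = {x \<in> X. g (f x) \<noteq> g x}"
    by auto
  ultimately show ?thesis by (simp add: even_sum_iff assms(1))
qed

section \<open>Rank-nullity by counting over the field with two elements\<close>

lemma card_le_card_image_times:
  assumes "finite A" and "f ` A \<subseteq> B" and "finite B"
    and "\<And>b. b \<in> B \<Longrightarrow> card {a \<in> A. f a = b} \<le> k"
  shows "card A \<le> card B * k"
proof -
  have "card A = (\<Sum>b\<in>B. card {a \<in> A. f a = b})"
    using assms(1-3) by (subst card_eq_sum, subst sum.group[symmetric, of A B f]) auto
  also have "\<dots> \<le> card B * k" using sum_bounded_above[OF assms(4), of B] by simp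
  finally show ?thesis .
qed

text \<open>Under symmetric difference sets form a vector space over the field with two elements and
  \<open>\<phi>\<close> is linear, so every nonempty fibre is a translate of the kernel.\<close>

lemma card_le_card_kernel:
  fixes \<phi> :: "'a set \<Rightarrow> 'b set"
  assumes "finite G" and "\<And>x y. x \<in> G \<Longrightarrow> y \<in> G \<Longrightarrow> sym_diff x y \<in> G"
    and "\<And>x y. x \<in> G \<Longrightarrow> y \<in> G \<Longrightarrow> \<phi> (sym_diff x y) = sym_diff (\<phi> x) (\<phi> y)"
    and "\<phi> ` G \<subseteq> B" and "finite B" and "card {x \<in> G. \<phi> x = {}} \<le> k"
  shows "card G \<le> card B * k"
proof (rule card_le_card_image_times[OF assms(1,4,5)])
  fix b assume "b \<in> B"
  show "card {a \<in> G. \<phi> a = b} \<le> k"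
  proof (cases "\<exists>x\<in>G. \<phi> x = b")
    case False
    then have "{a \<in> G. \<phi> a = b} = {}" by auto
    then show ?thesis by (simp only: card.empty)
  next
    case True
    then obtain x where x: "x \<in> G" "\<phi> x = b" by auto
    have "inj_on (sym_diff x) {a \<in> G. \<phi> a = b}" by (rule inj_onI) blast
    moreover have "sym_diff x ` {a \<in> G. \<phi> a = b} \<subseteq> {x \<in> G. \<phi> x = {}}"
    proof
      fix z assume "z \<in> sym_diff x ` {a \<in> G. \<phi> a = b}"
      then obtain a where a: "a \<in> G" "\<phi> a = b" "z = sym_diff x a" by auto
      have "\<phi> z = sym_diff b b" unfolding a(3) using assms(3)[OF x(1) a(1)] x(2) a(2) by simp
      moreover have "z \<in> G" unfolding a(3) using assms(2) x(1) a(1) .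
      ultimately show "z \<in> {x \<in> G. \<phi> x = {}}" by auto
    qed
    ultimately have "card {a \<in> G. \<phi> a = b} \<le> card {x \<in> G. \<phi> x = {}}"
      using assms(1) by (intro card_inj_on_le) auto
    then show ?thesis using assms(6) by simp
  qed
qed

text \<open>
  Row rank equals column rank over the field with two elements, in the form of a double count
  of the sum of \<open>(-1)\<close> to the bilinear form defined by the matrix.
\<close>

lemma sum_Pow_sign:
  fixes a :: "'a \<Rightarrow> nat"
  assumes "finite A"
  shows "(\<Sum>Z\<in>Pow A. (-1 :: int) ^ (\<Sum>x\<in>Z. a x)) = (if \<forall>x\<in>A. even (a x) then 2 ^ card A else 0)"
proof -
  \<comment> \<open>Choosing a summand in each factor of the product enumerates the subsets of
    \<open>A\<close>; one odd exponent gives a factor 0.\<close>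
  have "(\<Sum>Z\<in>Pow A. (-1 :: int) ^ (\<Sum>x\<in>Z. a x)) = (\<Prod>x\<in>A. (-1) ^ a x + 1)"
    using prod_add[OF assms, of "\<lambda>x. (-1 :: int) ^ a x" "\<lambda>_. 1"] by (simp add: power_sum)
  also have "\<dots> = (if \<forall>x\<in>A. even (a x) then 2 ^ card A else 0)"
  proof (cases "\<forall>x\<in>A. even (a x)")
    case True
    then have "(\<Prod>x\<in>A. (-1 :: int) ^ a x + 1) = (\<Prod>x\<in>A. 2)" by (intro prod.cong) auto
    then show ?thesis using True by simp
  next
    case False
    then show ?thesis using assms by (auto intro!: bexI simp: prod_zero_iff)
  qed
  finally show ?thesis .
qed

lemma card_kernel_transpose:
  fixes m :: "'a \<Rightarrow> 'b \<Rightarrow> nat"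
  assumes "finite A" and "finite B"
  shows "2 ^ card A * card {u \<in> Pow B. \<forall>x\<in>A. even (\<Sum>y\<in>u. m x y)} =
         2 ^ card B * card {Z \<in> Pow A. \<forall>y\<in>B. even (\<Sum>x\<in>Z. m x y)}"
proof -
  have 1: "(\<Sum>u\<in>Pow B. \<Sum>Z\<in>Pow A. (-1 :: int) ^ (\<Sum>x\<in>Z. \<Sum>y\<in>u. m x y)) =
      2 ^ card A * int (card {u \<in> Pow B. \<forall>x\<in>A. even (\<Sum>y\<in>u. m x y)})"
    using assms by (simp add: sum_Pow_sign sum.If_cases Int_def)
  have "(\<Sum>u\<in>Pow B. \<Sum>Z\<in>Pow A. (-1 :: int) ^ (\<Sum>x\<in>Z. \<Sum>y\<in>u. m x y)) =
      (\<Sum>Z\<in>Pow A. \<Sum>u\<in>Pow B. (-1 :: int) ^ (\<Sum>y\<in>u. \<Sum>x\<in>Z. m x y))"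
    by (subst sum.swap, intro sum.cong refl arg_cong[where f = "power (-1)"] sum.swap)
  also have "\<dots> = 2 ^ card B * int (card {Z \<in> Pow A. \<forall>y\<in>B. even (\<Sum>x\<in>Z. m x y)})"
    using assms by (simp add: sum_Pow_sign sum.If_cases Int_def)
  finally show ?thesis unfolding 1
    by (metis (mono_tags, lifting) of_nat_eq_iff of_nat_mult of_nat_numeral of_nat_power)
qed

section \<open>Corners, regions and Seifert circles\<close>

text \<open>Draw both strands upwards. The Seifert circle entering along the rightward strand leaves
  along the other one and so passes to the left of the crossing: the crossing is on the right of the
  circle entering by \<open>p\<close>.\<close>

definition right_of :: "'c diagram \<Rightarrow> 'c passage \<Rightarrow> bool" where
  "right_of D p \<longleftrightarrow> snd p = rightward D (fst p)"

text \<open>The corner used here is the one between the two outgoing ends. Together with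
  \<open>bottom_region\<close>, at the corner between the incoming ends, this gives the pair of
  non-Seifert circle regions.\<close>

definition top_region :: "'c diagram \<Rightarrow> 'c \<Rightarrow> 'c endpoint set" where
  "top_region D c = region D ((c, rightward D c), Outgoing)"

definition bottom_region :: "'c diagram \<Rightarrow> 'c \<Rightarrow> 'c endpoint set" where
  "bottom_region D c = region D ((c, rightward D c), Incoming)"

definition circles :: "'c diagram \<Rightarrow> 'c passage set set" where
  "circles D = orbit (seifert_next D) ` passages D"

text \<open>A Seifert circle is stored as the set of passages by which it enters crossings.
  \<open>True\<close> stands for its right side, \<open>False\<close> for its left side.\<close>

definition side :: "'c diagram \<Rightarrow> bool \<Rightarrow> 'c passage set \<Rightarrow> 'c passage set" where
  "side D i C = {p \<in> C. right_of D p = i}"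

definition separating :: "'c diagram \<Rightarrow> 'c passage set set" where
  "separating D = {C \<in> circles D. side D True C \<noteq> {} \<and> side D False C \<noteq> {}}"

definition sides :: "'c diagram \<Rightarrow> (bool \<times> 'c passage set) set" where
  "sides D = {(i, C). C \<in> circles D \<and> side D i C \<noteq> {}}"

text \<open>Regions as vertices and crossings as edges joining their two non-Seifert circle regions
  form a graph; this is the edge cut of a set of vertices. Twist classes are the classes of parallel
  edges.\<close>

definition boundary_cut :: "'c diagram \<Rightarrow> 'c endpoint set set \<Rightarrow> 'c set" where
  "boundary_cut D y = {c \<in> crossings D. (top_region D c \<in> y) \<noteq> (bottom_region D c \<in> y)}"

lemma other_other [simp]: "other (other s) = s"
  by (cases s) auto

lemma other_neq [simp]: "other s \<noteq> s" "s \<noteq> other s"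
  by (cases s; simp)+

lemma other_eq_iff: "other s = t \<longleftrightarrow> s \<noteq> t"
  by (cases s; cases t) auto

lemma other_inject [simp]: "other s = other t \<longleftrightarrow> s = t"
  by (cases s; cases t) auto

lemma opposite_opposite [simp]: "opposite (opposite d) = d"
  by (cases d) auto

lemma opposite_neq [simp]: "opposite d \<noteq> d" "d \<noteq> opposite d"
  by (cases d; simp)+

lemma UNIV_strand: "UNIV = {Over, Under}"
  using strand.exhaust by auto

lemma UNIV_direction: "UNIV = {Incoming, Outgoing}"
  using direction.exhaust by auto

lemma finite_UNIV_strand [simp]: "finite (UNIV :: strand set)"
  by (simp add: UNIV_strand)

lemma finite_UNIV_direction [simp]: "finite (UNIV :: direction set)"
  by (simp add: UNIV_direction)

lemma card_UNIV_strand [simp]: "card (UNIV :: strand set) = 2"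
  by (simp add: UNIV_strand)

text \<open>Working form of the hypotheses: planarity of a single piece becomes the region count of
  Euler's formula, connectedness says that no proper nonempty set of crossings is closed along the
  strands, and reducedness separates the two non-Seifert corners of a crossing.\<close>

locale reduced_diagram =
  fixes D :: "'c diagram"
  assumes finite_crossings [simp]: "finite (crossings D)"
    and permutes: "next_passage D permutes passages D"
    and card_regions: "card (regions D) = card (crossings D) + 2"
    and connected: "\<And>Z. Z \<subseteq> crossings D \<Longrightarrow>
      (\<And>p. p \<in> passages D \<Longrightarrow> fst p \<in> Z \<longleftrightarrow> fst (next_passage D p) \<in> Z) \<Longrightarrow>
      Z = {} \<or> Z = crossings D"
    and top_neq_bottom: "\<And>c. c \<in> crossings D \<Longrightarrow> top_region D c \<noteq> bottom_region D c"
    and crossings_nonempty: "crossings D \<noteq> {}"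
begin

abbreviation "bd \<equiv> across D \<circ> rot D"
abbreviation "rw \<equiv> rightward D"

lemma finite_passages [simp]: "finite (passages D)"
  by (simp add: passages_def finite_cartesian_product)

lemma finite_ends [simp]: "finite (ends D)"
  by (simp add: ends_def finite_cartesian_product)

lemma card_passages: "card (passages D) = 2 * card (crossings D)"
  by (simp add: passages_def card_cartesian_product)

lemma next_in [simp]: "next_passage D p \<in> passages D \<longleftrightarrow> p \<in> passages D"
  using permutes by (rule permutes_in_image)

lemma bij_next: "bij_betw (next_passage D) (passages D) (passages D)"
  using permutes by (rule permutes_imp_bij)

lemma inv_next [simp]: "inv (next_passage D) (next_passage D p) = p"
  "next_passage D (inv (next_passage D) p) = p"
  using permutes_inverses[OF permutes] by simp_all

lemma inv_next_in [simp]: "inv (next_passage D) p \<in> passages D \<longleftrightarrow> p \<in> passages D"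
  using permutes_in_image[OF permutes_inv[OF permutes]] .

lemma passages_fst: "p \<in> passages D \<longleftrightarrow> fst p \<in> crossings D"
  by (cases p) (auto simp: passages_def)

lemma passages_other [simp]: "(c, other s) \<in> passages D \<longleftrightarrow> (c, s) \<in> passages D"
  by (simp add: passages_def)

lemma ends_iff [simp]: "(p, d) \<in> ends D \<longleftrightarrow> p \<in> passages D"
  by (auto simp: ends_def)

lemma bij_seifert: "bij_betw (seifert_next D) (passages D) (passages D)"
proof (rule bij_betwI')
  show "seifert_next D p = seifert_next D q \<longleftrightarrow> p = q" for p q
  proof
    assume "seifert_next D p = seifert_next D q"
    then have "next_passage D (fst p, other (snd p)) = next_passage D (fst q, other (snd q))"
      by (simp add: seifert_next_def split_beta)
    then have "(fst p, other (snd p)) = (fst q, other (snd q))"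
      by (metis inv_next(1))
    then have "fst p = fst q" "other (other (snd p)) = other (other (snd q))" by simp_all
    then show "p = q" by (simp add: prod_eq_iff)
  qed simp
  show "seifert_next D p \<in> passages D" if "p \<in> passages D" for p
    using that by (cases p) (simp add: seifert_next_def)
  show "\<exists>p\<in>passages D. q = seifert_next D p" if "q \<in> passages D" for q
  proof -
    obtain c s where cs: "inv (next_passage D) q = (c, s)" by fastforce
    then have "(c, other s) \<in> passages D" using that by (metis inv_next_in passages_other)
    moreover have "q = seifert_next D (c, other s)"
      using cs by (simp add: seifert_next_def) (metis inv_next(2))
    ultimately show ?thesis by blast
  qed
qed

lemma seifert_in [simp]: "p \<in> passages D \<Longrightarrow> seifert_next D p \<in> passages D"
  using bij_seifert by (auto simp: bij_betw_def)

lemma across_across [simp]: "across D (across D h) = h"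
  by (cases h; cases "snd h") auto

lemma across_in [simp]: "across D h \<in> ends D \<longleftrightarrow> h \<in> ends D"
  by (cases h; cases "snd h") auto

lemma rot4 [simp]: "rot D (rot D (rot D (rot D h))) = h"
  by (cases h) (auto simp: other_eq_iff split: prod.splits)

lemma rot_in [simp]: "rot D h \<in> ends D \<longleftrightarrow> h \<in> ends D"
  by (cases h) (auto simp: ends_def passages_def split: prod.splits)

lemma bij_bd: "bij_betw bd (ends D) (ends D)"
proof (rule bij_betw_byWitness[where f' = "\<lambda>h. rot D (rot D (rot D (across D h)))"])
qed auto

lemma region_subset: "h \<in> ends D \<Longrightarrow> region D h \<subseteq> ends D"
  unfolding region_def using bij_bd by (intro orbit_subset_of_closed) (auto simp: bij_betw_def)

lemma in_region_self: "h \<in> ends D \<Longrightarrow> h \<in> region D h"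
  unfolding region_def using bij_bd by (intro orbit_self) auto

lemma region_eq: "h \<in> ends D \<Longrightarrow> k \<in> region D h \<Longrightarrow> region D k = region D h"
  unfolding region_def using bij_bd finite_ends by (intro orbit_eq) auto

lemma region_bd: "h \<in> ends D \<Longrightarrow> region D (bd h) = region D h"
  by (rule region_eq) (simp_all add: region_def orbit.base del: o_apply)

lemma in_region_iff: "h \<in> ends D \<Longrightarrow> r \<in> regions D \<Longrightarrow> h \<in> r \<longleftrightarrow> region D h = r"
  unfolding regions_def using region_eq in_region_self by blast

lemma regions_subset: "r \<in> regions D \<Longrightarrow> r \<subseteq> ends D"
  unfolding regions_def using region_subset by blast

lemma finite_regions [simp]: "finite (regions D)"
  by (simp add: regions_def)

lemma region_in [simp]: "h \<in> ends D \<Longrightarrow> region D h \<in> regions D"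
  by (simp add: regions_def)

lemma top_in [simp]: "c \<in> crossings D \<Longrightarrow> top_region D c \<in> regions D"
  by (simp add: top_region_def passages_def)

lemma bottom_in [simp]: "c \<in> crossings D \<Longrightarrow> bottom_region D c \<in> regions D"
  by (simp add: bottom_region_def passages_def)

lemma circle_eq: "C \<in> circles D \<Longrightarrow> p \<in> C \<Longrightarrow> C = orbit (seifert_next D) p"
  unfolding circles_def using orbit_eq[OF finite_passages bij_seifert] by blast

lemma circle_subset: "C \<in> circles D \<Longrightarrow> C \<subseteq> passages D"
  unfolding circles_def using bij_seifert orbit_subset_of_closed[of "seifert_next D" "passages D"]
  by (auto simp: bij_betw_def)

lemma finite_circles [simp]: "finite (circles D)"
  by (simp add: circles_def)

lemma finite_circle: "C \<in> circles D \<Longrightarrow> finite C"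
  using circle_subset finite_passages finite_subset by blast

lemma bij_circle: "C \<in> circles D \<Longrightarrow> bij_betw (seifert_next D) C C"
  unfolding circles_def using bij_betw_orbit[OF finite_passages bij_seifert] by auto

lemma circle_of: "p \<in> passages D \<Longrightarrow> p \<in> orbit (seifert_next D) p"
  by (rule orbit_self[OF finite_passages bij_seifert])

lemma orbit_in_circles [simp]: "p \<in> passages D \<Longrightarrow> orbit (seifert_next D) p \<in> circles D"
  by (simp add: circles_def)

lemma circle_nonempty: "C \<in> circles D \<Longrightarrow> C \<noteq> {}"
  by (auto simp: circles_def orbit_nonempty)

lemma side_Un: "side D True C \<union> side D False C = C"
  by (auto simp: side_def)

abbreviation inc :: "'c passage \<Rightarrow> 'c endpoint" where "inc p \<equiv> (p, Incoming)"
abbreviation out :: "'c passage \<Rightarrow> 'c endpoint" where "out p \<equiv> ((fst p, other (snd p)), Outgoing)"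

text \<open>
  Running along a Seifert circle, \<open>inc\<close> names the corners on its right and \<open>out\<close>
  those on its left. A corner of the one kind is followed in its region by the next corner along
  the circle, one of the other kind by the previous one; this fails exactly at the corners between
  two outgoing or two incoming ends.
\<close>

lemma bd_inc: "\<not> right_of D p \<Longrightarrow> bd (inc p) = inc (seifert_next D p)"
  by (cases p) (simp add: right_of_def seifert_next_def)

lemma bd_top: "right_of D p \<Longrightarrow> bd ((fst p, rw (fst p)), Outgoing) = inc (seifert_next D p)"
  by (cases p) (simp add: right_of_def seifert_next_def)

lemma inc_bottom: "right_of D p \<Longrightarrow> inc p = ((fst p, rw (fst p)), Incoming)"
  by (cases p) (simp add: right_of_def)

lemma bd_out:
  assumes "right_of D (seifert_next D p)"
  shows "bd (out (seifert_next D p)) = out p"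
proof -
  obtain c s where cs: "seifert_next D p = (c, s)" by fastforce
  then have "s = rw c" using assms by (simp add: right_of_def)
  moreover have "inv (next_passage D) (c, s) = (fst p, other (snd p))"
    using cs by (cases p) (simp add: seifert_next_def, metis inv_next(1))
  ultimately show ?thesis using cs by simp
qed

lemma bd_bottom:
  assumes "\<not> right_of D (seifert_next D p)"
  shows "bd ((fst (seifert_next D p), rw (fst (seifert_next D p))), Incoming) = out p"
proof -
  obtain c s where cs: "seifert_next D p = (c, s)" by fastforce
  then have "other (rw c) = s" using assms by (simp add: right_of_def other_eq_iff)
  moreover have "inv (next_passage D) (c, s) = (fst p, other (snd p))"
    using cs by (cases p) (simp add: seifert_next_def, metis inv_next(1))
  ultimately show ?thesis using cs by simp
qed

lemma out_top: "\<not> right_of D p \<Longrightarrow> out p = ((fst p, rw (fst p)), Outgoing)"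
  by (cases p) (simp add: right_of_def other_eq_iff)

section \<open>Regions flanking a Seifert circle\<close>

definition corner :: "bool \<Rightarrow> 'c passage \<Rightarrow> 'c endpoint" where
  "corner i p = (if i then inc p else out p)"

text \<open>The right flank is read off at the edge by which the circle enters the crossing, the
  left flank at the edge by which it leaves. This causes the shift by \<open>seifert_next\<close>
  between the two halves of the next two lemmas.\<close>

definition flank :: "bool \<Rightarrow> 'c passage \<Rightarrow> 'c endpoint set" where
  "flank i p = region D (corner i p)"

lemma flank_same:
  assumes "p \<in> passages D"
  shows "\<not> right_of D p \<Longrightarrow> flank True (seifert_next D p) = flank True p"
    and "right_of D (seifert_next D p) \<Longrightarrow> flank False (seifert_next D p) = flank False p"
proof -
  show "\<not> right_of D p \<Longrightarrow> flank True (seifert_next D p) = flank True p"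
    using region_bd[of "inc p"] bd_inc[of p] assms by (simp add: flank_def corner_def)
  show "right_of D (seifert_next D p) \<Longrightarrow> flank False (seifert_next D p) = flank False p"
    using region_bd[of "out (seifert_next D p)"] bd_out[of p] seifert_in[OF assms]
    by (simp add: flank_def corner_def passages_fst)
qed

text \<open>On the side where a crossing lies, the flank passes from its bottom to its top region;
  elsewhere the flank stays. Changes of the flank thus detect the crossings on a side.\<close>

lemma flank_change:
  assumes "p \<in> passages D"
  shows "right_of D p \<Longrightarrow> flank True p = bottom_region D (fst p) \<and>
           flank True (seifert_next D p) = top_region D (fst p)"
    and "\<not> right_of D (seifert_next D p) \<Longrightarrow>
           flank False p = bottom_region D (fst (seifert_next D p)) \<and>
           flank False (seifert_next D p) = top_region D (fst (seifert_next D p))"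
proof -
  show "right_of D p \<Longrightarrow> flank True p = bottom_region D (fst p) \<and>
           flank True (seifert_next D p) = top_region D (fst p)"
    using region_bd[of "((fst p, rw (fst p)), Outgoing)"] bd_top[of p] inc_bottom[of p] assms
    by (simp add: flank_def corner_def bottom_region_def top_region_def passages_fst)
  show "\<not> right_of D (seifert_next D p) \<Longrightarrow>
           flank False p = bottom_region D (fst (seifert_next D p)) \<and>
           flank False (seifert_next D p) = top_region D (fst (seifert_next D p))"
    using region_bd[of "((fst (seifert_next D p), rw (fst (seifert_next D p))), Incoming)"]
      bd_bottom[of p] out_top[of "seifert_next D p"] seifert_in[OF assms]
    by (simp add: flank_def corner_def bottom_region_def top_region_def passages_fst)
qed

text \<open>Membership in \<open>y\<close> of the region flanking \<open>C\<close> on side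
  \<open>i\<close> flips exactly at the crossings of the cut on that side, and a closed walk flips
  evenly often.\<close>

lemma even_side:
  assumes C: "C \<in> circles D"
  shows "even (card {p \<in> side D i C. fst p \<in> boundary_cut D y})"
proof -
  note sub = circle_subset[OF C]
  let ?X = "{q \<in> C. (flank i (seifert_next D q) \<in> y) \<noteq> (flank i q \<in> y)}"
  have even: "even (card ?X)"
    using even_card_changes[OF finite_circle bij_circle, of C "\<lambda>q. flank i q \<in> y"] C by simp
  show ?thesis
  proof (cases i)
    case True
    have "(flank i (seifert_next D q) \<in> y) \<noteq> (flank i q \<in> y) \<longleftrightarrow>
        right_of D q \<and> fst q \<in> boundary_cut D y" if "q \<in> C" for q
      using that sub flank_same(1)[of q] flank_change(1)[of q] True
      by (cases "right_of D q") (auto simp: boundary_cut_def passages_fst)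
    then have "?X = {p \<in> side D i C. fst p \<in> boundary_cut D y}"
      using True by (auto simp: side_def)
    then show ?thesis using even by simp
  next
    case False
    let ?Y = "{p \<in> side D i C. fst p \<in> boundary_cut D y}"
    have *: "(flank i (seifert_next D q) \<in> y) \<noteq> (flank i q \<in> y) \<longleftrightarrow>
        \<not> right_of D (seifert_next D q) \<and> fst (seifert_next D q) \<in> boundary_cut D y"
      if "q \<in> C" for q
      using that sub flank_same(2)[of q] flank_change(2)[of q] False seifert_in[of q]
      by (cases "right_of D (seifert_next D q)") (auto simp: boundary_cut_def passages_fst)
    \<comment> \<open>On the left the flip between \<open>q\<close> and its successor happens at the
      crossing of the successor, so \<open>seifert_next\<close> carries the flips to the passages
      counted.\<close>
    have img: "seifert_next D ` ?X = ?Y"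
    proof
      show "seifert_next D ` ?X \<subseteq> ?Y"
      proof
        fix p assume "p \<in> seifert_next D ` ?X"
        then obtain q where "q \<in> ?X" "p = seifert_next D q" by blast
        moreover from this have "p \<in> C" using bij_circle[OF C] by (auto simp: bij_betw_def)
        ultimately show "p \<in> ?Y" using *[of q] False by (simp add: side_def)
      qed
      show "?Y \<subseteq> seifert_next D ` ?X"
      proof
        fix p assume p: "p \<in> ?Y"
        then have "p \<in> seifert_next D ` C"
          using bij_circle[OF C] by (simp add: side_def bij_betw_def)
        then obtain q where "q \<in> C" "p = seifert_next D q" by blast
        moreover from this have "q \<in> ?X" using p *[of q] False by (simp add: side_def)
        ultimately show "p \<in> seifert_next D ` ?X" by blast
      qed
    qed
    have inj: "inj_on (seifert_next D) ?X"
      using bij_circle[OF C] by (auto simp: bij_betw_def intro: inj_on_subset)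
    have "card ?Y = card ?X" unfolding img[symmetric] by (rule card_image[OF inj])
    then show ?thesis using even by (simp only:)
  qed
qed

text \<open>A lone crossing on a side would make the cut of its top region meet this side exactly
  once.\<close>

lemma side_degree_ge:
  assumes C: "C \<in> circles D" and "side D i C \<noteq> {}"
  shows "card (side D i C) \<ge> 2"
proof (rule ccontr)
  have fin: "finite (side D i C)" using finite_circle[OF C] by (simp add: side_def)
  assume "\<not> card (side D i C) \<ge> 2"
  then have "card (side D i C) = 1" using assms fin
    by (metis One_nat_def card_0_eq less_2_cases not_le)
  then obtain p where p: "side D i C = {p}" by (rule card_1_singletonE)
  then have "p \<in> passages D" using circle_subset[OF C] by (auto simp: side_def)
  then have "fst p \<in> boundary_cut D {top_region D (fst p)}"
    using top_neq_bottom[of "fst p"] by (auto simp: boundary_cut_def passages_fst)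
  then have "{q \<in> side D i C. fst q \<in> boundary_cut D {top_region D (fst p)}} = {p}"
    using p by auto
  then show False using even_side[OF C, of i "{top_region D (fst p)}"] by simp
qed

lemma non_seifert_regions_eq: "non_seifert_regions D c = {top_region D c, bottom_region D c}"
proof -
  have "{h. h \<in> ends_at c \<and> snd h = snd (rot D h)} = {((c, rw c), Outgoing), ((c, rw c), Incoming)}"
    by (auto simp: ends_at_def split: if_splits) (metis direction.exhaust)+
  then show ?thesis
    unfolding non_seifert_regions_def top_region_def bottom_region_def setcompr_eq_image by simp
qed

text \<open>If a non-Seifert circle region of one crossing of the bigon were not one of the other,
  its cut would meet the side in one crossing only.\<close>

lemma bigon_twist_equiv:
  assumes C: "C \<in> circles D" and "card (side D i C) = 2" and pq: "p \<in> side D i C" "q \<in> side D i C"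
  shows "(fst p, fst q) \<in> twist_equiv D"
proof (cases "p = q")
  case True
  then show ?thesis using pq circle_subset[OF C]
    by (auto simp: twist_equiv_def side_def passages_fst)
next
  case False
  then have pq_eq: "side D i C = {p, q}"
    using assms(2) pq by (metis (no_types, lifting) card_2_iff doubleton_eq_iff insert_iff singleton_iff)
  have c: "fst p \<in> crossings D" "fst q \<in> crossings D"
    using pq circle_subset[OF C] by (auto simp: side_def passages_fst)
  have *: "r \<in> {top_region D (fst q), bottom_region D (fst q)}"
    if "r \<in> {top_region D (fst p), bottom_region D (fst p)}" for r
  proof (rule ccontr)
    assume "r \<notin> {top_region D (fst q), bottom_region D (fst q)}"
    then have "fst q \<notin> boundary_cut D {r}" by (auto simp: boundary_cut_def)
    moreover have "fst p \<in> boundary_cut D {r}"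
      using that c top_neq_bottom[of "fst p"] by (auto simp: boundary_cut_def)
    ultimately have "{p \<in> side D i C. fst p \<in> boundary_cut D {r}} = {p}"
      using pq_eq by auto
    then show False using even_side[OF C, of i "{r}"] by simp
  qed
  then have "{top_region D (fst p), bottom_region D (fst p)} =
      {top_region D (fst q), bottom_region D (fst q)}"
    using top_neq_bottom[OF c(1)] top_neq_bottom[OF c(2)] by auto
  then show ?thesis using c by (simp add: twist_equiv_def non_seifert_regions_eq)
qed

section \<open>Sides of Seifert circles and twist classes\<close>

abbreviation part :: "bool \<times> 'c passage set \<Rightarrow> 'c passage set" where
  "part s \<equiv> side D (fst s) (snd s)"

definition side_of :: "'c passage \<Rightarrow> bool \<times> 'c passage set" where
  "side_of p = (right_of D p, orbit (seifert_next D) p)"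

lemma finite_sides [simp]: "finite (sides D)"
  by (rule finite_subset[of _ "UNIV \<times> circles D"]) (auto simp: sides_def)

lemma finite_separating [simp]: "finite (separating D)"
  by (simp add: separating_def)

text \<open>A separating circle has two nonempty sides, every other circle exactly one.\<close>

lemma card_sides: "card (sides D) = card (circles D) + card (separating D)"
proof -
  let ?A = "\<lambda>i. {C \<in> circles D. side D i C \<noteq> {}}"
  have "sides D = Pair True ` ?A True \<union> Pair False ` ?A False"
  proof (rule set_eqI)
    show "s \<in> sides D \<longleftrightarrow> s \<in> Pair True ` ?A True \<union> Pair False ` ?A False" for s
      by (cases s; cases "fst s") (auto simp: sides_def)
  qed
  then have "card (sides D) = card (Pair True ` ?A True) + card (Pair False ` ?A False)"
    by (simp only:) (rule card_Un_disjoint, auto)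
  also have "\<dots> = card (?A True) + card (?A False)"
    by (simp add: card_image inj_on_def)
  also have "\<dots> = card (?A True \<union> ?A False) + card (?A True \<inter> ?A False)"
    by (rule card_Un_Int) auto
  also have "?A True \<union> ?A False = circles D"
  proof -
    have "side D True C \<noteq> {} \<or> side D False C \<noteq> {}" if "C \<in> circles D" for C
      using side_Un[of C] circle_nonempty[OF that] by auto
    then show ?thesis by blast
  qed
  also have "?A True \<inter> ?A False = separating D"
    by (auto simp: separating_def)
  finally show ?thesis .
qed

lemma sidesD: "s \<in> sides D \<Longrightarrow> snd s \<in> circles D" "s \<in> sides D \<Longrightarrow> part s \<noteq> {}"
  by (auto simp: sides_def)

lemma part_subset: "s \<in> sides D \<Longrightarrow> part s \<subseteq> passages D"
  using circle_subset[OF sidesD(1)] unfolding side_def by blast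

lemma finite_part: "s \<in> sides D \<Longrightarrow> finite (part s)"
  using part_subset finite_passages finite_subset by blast

lemma side_of_in: "p \<in> passages D \<Longrightarrow> side_of p \<in> sides D"
  using circle_of[of p] orbit_in_circles[of p] unfolding sides_def side_of_def side_def by blast

lemma in_part_side_of: "p \<in> passages D \<Longrightarrow> p \<in> part (side_of p)"
  using circle_of by (auto simp: side_of_def side_def)

lemma side_of_eq: "s \<in> sides D \<Longrightarrow> p \<in> part s \<Longrightarrow> side_of p = s"
  using circle_eq[of "snd s" p] sidesD(1)[of s] by (auto simp: side_of_def side_def prod_eq_iff)

lemma parts_disjoint: "s \<in> sides D \<Longrightarrow> s' \<in> sides D \<Longrightarrow> s \<noteq> s' \<Longrightarrow> part s \<inter> part s' = {}"
  using side_of_eq by blast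

lemma card_Union_parts: "S \<subseteq> sides D \<Longrightarrow> card (\<Union>s\<in>S. part s) = (\<Sum>s\<in>S. card (part s))"
  using parts_disjoint finite_part finite_subset[OF _ finite_sides]
  by (intro card_UN_disjoint) (blast+)

lemma sum_parts: "(\<Sum>s\<in>sides D. card (part s)) = 2 * card (crossings D)"
proof -
  have "(\<Union>s\<in>sides D. part s) = passages D"
    using part_subset side_of_in in_part_side_of by blast
  then show ?thesis using card_Union_parts[of "sides D"] card_passages by simp
qed

lemma part_degree_ge: "s \<in> sides D \<Longrightarrow> card (part s) \<ge> 2"
  using side_degree_ge sidesD by blast

lemma bigon_equiv:
  "s \<in> sides D \<Longrightarrow> card (part s) = 2 \<Longrightarrow> p \<in> part s \<Longrightarrow> q \<in> part s \<Longrightarrow>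
    (fst p, fst q) \<in> twist_equiv D"
  using bigon_twist_equiv sidesD(1) by blast

lemma part_eq_circle: "s \<in> sides D \<Longrightarrow> snd s \<notin> separating D \<Longrightarrow> part s = snd s"
  using side_Un[of "snd s"] sidesD[of s] by (cases "fst s") (auto simp: separating_def)

section \<open>Unions of components of the graph joining crossings to their sides\<close>

definition side_closed :: "'c set \<Rightarrow> bool" where
  "side_closed Z \<longleftrightarrow> Z \<subseteq> crossings D \<and>
     (\<forall>s\<in>sides D. \<forall>p\<in>part s. \<forall>q\<in>part s. fst p \<in> Z \<longleftrightarrow> fst q \<in> Z)"

lemma side_closedD:
  assumes "side_closed Z" and "s \<in> sides D" and "p \<in> part s" and "q \<in> part s"
  shows "fst p \<in> Z \<longleftrightarrow> fst q \<in> Z"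
  by (rule bspec[OF bspec[OF bspec[OF conjunct2[OF assms(1)[unfolded side_closed_def]] assms(2)]
      assms(3)] assms(4)])

text \<open>\<open>seifert_next\<close> is \<open>next_passage\<close> after a change of strand at
  the same crossing, so Seifert circles and strands connect the same crossings.\<close>

lemma connected_circles:
  assumes "Z \<subseteq> crossings D"
    and "\<And>p. p \<in> passages D \<Longrightarrow> fst p \<in> Z \<longleftrightarrow> fst (seifert_next D p) \<in> Z"
  shows "Z = {} \<or> Z = crossings D"
proof (rule connected[OF assms(1)])
  fix p assume "p \<in> passages D"
  then show "fst p \<in> Z \<longleftrightarrow> fst (next_passage D p) \<in> Z"
    using assms(2)[of "(fst p, other (snd p))"] by (simp add: seifert_next_def passages_fst)
qed

text \<open>\<open>\<phi>\<close> records the separating circles at which \<open>Z\<close> differs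
  between the two sides. On its kernel, \<open>Z\<close> is constant along every Seifert circle,
  hence empty or everything by connectedness.\<close>

lemma card_side_closed: "card {Z. side_closed Z} \<le> 2 ^ (card (separating D) + 1)"
proof -
  define \<phi> where "\<phi> Z = {C \<in> separating D.
    \<exists>p\<in>side D True C. \<exists>q\<in>side D False C. (fst p \<in> Z) \<noteq> (fst q \<in> Z)}" for Z
  have const: "(fst p \<in> Z) = (fst q \<in> Z)"
    if "side_closed Z" "C \<in> circles D" "p \<in> side D i C" "q \<in> side D i C" for Z C i p q
  proof -
    have "(i, C) \<in> sides D" using that by (auto simp: sides_def)
    then show ?thesis using side_closedD[OF that(1), of "(i, C)" p q] that(3,4) by simp
  qed
  have \<phi>_iff: "C \<in> \<phi> Z \<longleftrightarrow> (fst p \<in> Z) \<noteq> (fst q \<in> Z)"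
    if "side_closed Z" "C \<in> separating D" "p \<in> side D True C" "q \<in> side D False C" for Z C p q
  proof
    have C: "C \<in> circles D" using that(2) by (simp add: separating_def)
    assume "C \<in> \<phi> Z"
    then obtain p' q' where "p' \<in> side D True C" "q' \<in> side D False C" "(fst p' \<in> Z) \<noteq> (fst q' \<in> Z)"
      unfolding \<phi>_def by blast
    moreover have "(fst p \<in> Z) = (fst p' \<in> Z)" "(fst q \<in> Z) = (fst q' \<in> Z)"
      using const[OF that(1) C] that(3,4) calculation(1,2) by blast+
    ultimately show "(fst p \<in> Z) \<noteq> (fst q \<in> Z)" by simp
  next
    assume "(fst p \<in> Z) \<noteq> (fst q \<in> Z)"
    then show "C \<in> \<phi> Z" using that(2-4) unfolding \<phi>_def by blast
  qed
  have fin: "finite {Z. side_closed Z}"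
    by (rule finite_subset[of _ "Pow (crossings D)"]) (auto simp: side_closed_def)
  have sym: "side_closed (sym_diff Z Z')" if "side_closed Z" "side_closed Z'" for Z Z'
    unfolding side_closed_def
  proof (intro conjI ballI)
    show "sym_diff Z Z' \<subseteq> crossings D" using that unfolding side_closed_def by blast
    fix s p q assume "s \<in> sides D" "p \<in> part s" "q \<in> part s"
    then show "fst p \<in> sym_diff Z Z' \<longleftrightarrow> fst q \<in> sym_diff Z Z'"
      using side_closedD[OF that(1), of s p q] side_closedD[OF that(2), of s p q] by simp
  qed
  have "card {Z. side_closed Z} \<le> card (Pow (separating D)) * 2"
  proof (rule card_le_card_kernel[where \<phi> = \<phi>, OF fin])
    fix Z Z' assume Z: "Z \<in> {Z. side_closed Z}" "Z' \<in> {Z. side_closed Z}"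
    then show "sym_diff Z Z' \<in> {Z. side_closed Z}" using sym by simp
    show "\<phi> (sym_diff Z Z') = sym_diff (\<phi> Z) (\<phi> Z')"
    proof (rule set_eqI)
      fix C
      show "C \<in> \<phi> (sym_diff Z Z') \<longleftrightarrow> C \<in> sym_diff (\<phi> Z) (\<phi> Z')"
      proof (cases "C \<in> separating D")
        case True
        then obtain p q where pq: "p \<in> side D True C" "q \<in> side D False C"
          by (auto simp: separating_def)
        show ?thesis
          using \<phi>_iff[OF _ True pq, of Z] \<phi>_iff[OF _ True pq, of Z']
            \<phi>_iff[OF _ True pq, of "sym_diff Z Z'"] Z sym[of Z Z'] by auto
      qed (simp add: \<phi>_def)
    qed
  next
    have "Z = {} \<or> Z = crossings D" if Z: "side_closed Z" "\<phi> Z = {}" for Z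
    proof (rule connected_circles)
      show "Z \<subseteq> crossings D" using Z by (simp add: side_closed_def)
      fix p assume p: "p \<in> passages D"
      let ?C = "orbit (seifert_next D) p"
      have C: "?C \<in> circles D" "p \<in> ?C" "seifert_next D p \<in> ?C"
        using p circle_of orbit.base by auto
      have eq: "(fst a \<in> Z) = (fst b \<in> Z)" if "a \<in> side D True ?C" "b \<in> side D False ?C" for a b
      proof -
        have "?C \<in> separating D" using that C by (auto simp: separating_def)
        then show ?thesis using \<phi>_iff[OF Z(1) _ that] Z(2) by blast
      qed
      show "fst p \<in> Z \<longleftrightarrow> fst (seifert_next D p) \<in> Z"
      proof (cases "right_of D p = right_of D (seifert_next D p)")
        case True
        then show ?thesis
          using C by (intro const[OF Z(1) C(1), of _ "right_of D p"]) (simp_all add: side_def)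
      next
        case False
        then show ?thesis
          using C eq[of p "seifert_next D p"] eq[of "seifert_next D p" p]
          by (cases "right_of D p") (simp_all add: side_def)
      qed
    qed
    then have "{Z \<in> {Z. side_closed Z}. \<phi> Z = {}} \<subseteq> {{}, crossings D}" by blast
    then have "card {Z \<in> {Z. side_closed Z}. \<phi> Z = {}} \<le> card {{}, crossings D}"
      by (rule card_mono[rotated]) simp
    also have "\<dots> \<le> 2" by (simp add: card_insert_if)
    finally show "card {Z \<in> {Z. side_closed Z}. \<phi> Z = {}} \<le> 2" .
  qed (auto simp: \<phi>_def)
  then show ?thesis by (simp add: card_Pow)
qed

text \<open>Distinct subfamilies of \<open>F\<close> have distinct unions, all of them closed, so
  there are at least 2 ^ |F| closed sets.\<close>

lemma card_disjoint_side_closed: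
  assumes "finite F" and "pairwise disjnt F" and "\<And>Z. Z \<in> F \<Longrightarrow> side_closed Z \<and> Z \<noteq> {}"
  shows "card F \<le> card (separating D) + 1"
proof -
  have inj: "inj_on Union (Pow F)"
  proof (rule inj_onI)
    have sub: "A \<subseteq> B" if AB: "A \<subseteq> F" "B \<subseteq> F" "\<Union>A = \<Union>B" for A B
    proof
      fix Z assume Z: "Z \<in> A"
      then have "Z \<noteq> {}" using assms(3)[of Z] AB(1) by auto
      then obtain z where z: "z \<in> Z" by auto
      then obtain Y where Y: "Y \<in> B" "z \<in> Y" using AB(3) Z by blast
      then have "\<not> disjnt Z Y" using z by (auto simp: disjnt_def)
      then have "Z = Y" using pairwiseD[OF assms(2), of Z Y] AB(1,2) Z Y(1) by auto
      then show "Z \<in> B" using Y by simp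
    qed
    fix A B assume "A \<in> Pow F" "B \<in> Pow F" "\<Union>A = \<Union>B"
    then show "A = B" using sub[of A B] sub[of B A] by auto
  qed
  have un: "side_closed (\<Union>A)" if "A \<subseteq> F" for A
  proof -
    have *: "side_closed Z" if "Z \<in> A" for Z using that \<open>A \<subseteq> F\<close> assms(3) by blast
    show ?thesis unfolding side_closed_def
    proof (intro conjI ballI)
      show "\<Union>A \<subseteq> crossings D" using * unfolding side_closed_def by blast
      fix s p q assume "s \<in> sides D" "p \<in> part s" "q \<in> part s"
      then have "fst p \<in> Z \<longleftrightarrow> fst q \<in> Z" if "Z \<in> A" for Z
        using *[OF that] unfolding side_closed_def by blast
      then show "fst p \<in> \<Union>A \<longleftrightarrow> fst q \<in> \<Union>A" by blast
    qed
  qed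
  have fin: "finite {Z. side_closed Z}"
    by (rule finite_subset[of _ "Pow (crossings D)"]) (auto simp: side_closed_def)
  have "card (Pow F) \<le> card {Z. side_closed Z}"
    using un by (intro card_inj_on_le[OF inj _ fin]) auto
  then have "(2::nat) ^ card F \<le> 2 ^ (card (separating D) + 1)"
    using card_side_closed by (simp add: card_Pow assms(1))
  then show ?thesis by (rule power_le_imp_le_exp[rotated]) simp
qed

section \<open>Twist classes, full classes and bigons\<close>

lemma equiv_twist: "equiv (crossings D) (twist_equiv D)"
  by (rule equivI) (auto simp: twist_equiv_def refl_on_def sym_def trans_def)

lemma class_subset: "K \<in> twist_classes D \<Longrightarrow> K \<subseteq> crossings D"
  unfolding twist_classes_def using in_quotient_imp_subset[OF equiv_twist] .

lemma class_nonempty: "K \<in> twist_classes D \<Longrightarrow> K \<noteq> {}"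
  unfolding twist_classes_def using in_quotient_imp_non_empty[OF equiv_twist] .

lemma classes_disjoint: "K \<in> twist_classes D \<Longrightarrow> K' \<in> twist_classes D \<Longrightarrow> K \<noteq> K' \<Longrightarrow> K \<inter> K' = {}"
  unfolding twist_classes_def using quotient_disj[OF equiv_twist] by blast

lemma class_closed: "K \<in> twist_classes D \<Longrightarrow> (c, c') \<in> twist_equiv D \<Longrightarrow> c \<in> K \<longleftrightarrow> c' \<in> K"
  unfolding twist_classes_def
  using in_quotient_imp_closed[OF equiv_twist] equivE[OF equiv_twist] by (metis symD)

lemma Union_classes: "\<Union> (twist_classes D) = crossings D"
  unfolding twist_classes_def by (rule Union_quotient[OF equiv_twist])

lemma finite_classes [simp]: "finite (twist_classes D)"
  using Union_classes finite_crossings by (metis finite_UnionD)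

lemma finite_class: "K \<in> twist_classes D \<Longrightarrow> finite K"
  using class_subset finite_crossings finite_subset by blast

lemma sum_classes: "(\<Sum>K\<in>twist_classes D. card K) = card (crossings D)"
  using card_Union_disjoint[of "twist_classes D"] classes_disjoint finite_class
  by (simp add: Union_classes pairwise_def disjnt_def)

definition full_classes :: "'c set set" where
  "full_classes = {K \<in> twist_classes D. \<forall>p\<in>passages D. fst p \<in> K \<longrightarrow> card (part (side_of p)) = 2}"

text \<open>A bigon never leaves a twist class, and the crossings of a full class lie on bigons
  only.\<close>

lemma full_class_closed:
  assumes "K \<in> full_classes"
  shows "side_closed K"
proof -
  have K: "K \<in> twist_classes D" using assms by (simp add: full_classes_def)
  have *: "fst q \<in> K" if "s \<in> sides D" "p \<in> part s" "q \<in> part s" "fst p \<in> K" for s p q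
  proof -
    have "card (part s) = 2"
      using assms that side_of_eq[OF that(1,2)] part_subset[OF that(1)]
      by (auto simp: full_classes_def)
    then show ?thesis using bigon_equiv[OF that(1) _ that(2,3)] class_closed[OF K] that(4) by blast
  qed
  then show ?thesis using class_subset[OF K] unfolding side_closed_def by blast
qed

lemma finite_full [simp]: "finite full_classes"
  by (simp add: full_classes_def)

lemma full_disjoint: "pairwise disjnt full_classes"
  using classes_disjoint by (auto simp: full_classes_def pairwise_def disjnt_def)

lemma card_full_le: "card full_classes \<le> card (separating D) + 1"
  using full_class_closed class_nonempty
  by (intro card_disjoint_side_closed full_disjoint) (auto simp: full_classes_def)

text \<open>Otherwise the complement would be a further nonempty closed set disjoint from the full
  classes, one too many for \<open>card_disjoint_side_closed\<close>.\<close>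

lemma card_full_eq:
  assumes "card full_classes = card (separating D) + 1"
  shows "\<Union> full_classes = crossings D"
proof (rule ccontr)
  let ?Z = "crossings D - \<Union> full_classes"
  assume ne: "\<Union> full_classes \<noteq> crossings D"
  have sub: "\<Union> full_classes \<subseteq> crossings D"
    using class_subset by (auto simp: full_classes_def)
  have Z: "?Z \<noteq> {}" using ne sub by blast
  have "side_closed ?Z" unfolding side_closed_def
  proof (intro conjI ballI)
    fix s p q assume spq: "s \<in> sides D" "p \<in> part s" "q \<in> part s"
    then have "fst p \<in> K \<longleftrightarrow> fst q \<in> K" if "K \<in> full_classes" for K
      using full_class_closed[OF that] unfolding side_closed_def by blast
    moreover have "fst p \<in> crossings D" "fst q \<in> crossings D"
      using spq part_subset passages_fst by blast+
    ultimately show "fst p \<in> ?Z \<longleftrightarrow> fst q \<in> ?Z" by blast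
  qed blast
  moreover have "?Z \<notin> full_classes" using Z by blast
  moreover have "pairwise disjnt (insert ?Z full_classes)"
    using full_disjoint by (auto simp: pairwise_insert disjnt_def)
  ultimately have "card (insert ?Z full_classes) \<le> card (separating D) + 1"
    using Z full_class_closed class_nonempty
    by (intro card_disjoint_side_closed) (auto simp: full_classes_def)
  then show False using assms \<open>?Z \<notin> full_classes\<close> by simp
qed

text \<open>Each bigon of a class with k crossings uses two of its 2 k passages. In a class that is
  not full some passage is left over, so that it has at most k - 1 bigons.\<close>

lemma card_bigons_le:
  "card {s \<in> sides D. card (part s) = 2} + num_twist_classes D
     \<le> card (crossings D) + card full_classes"
proof -
  define B where "B K = {s \<in> sides D. card (part s) = 2 \<and> fst ` part s \<subseteq> K}" for K
  have finB: "finite (B K)" for K by (simp add: B_def)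
  have "{s \<in> sides D. card (part s) = 2} = (\<Union>K\<in>twist_classes D. B K)"
  proof (intro equalityI subsetI)
    fix s assume s: "s \<in> {s \<in> sides D. card (part s) = 2}"
    then obtain p where p: "p \<in> part s" using sidesD by blast
    then have "fst p \<in> crossings D" using s part_subset passages_fst by blast
    then obtain K where K: "K \<in> twist_classes D" "fst p \<in> K" using Union_classes by blast
    then have "s \<in> B K" using s p bigon_equiv[of s p] class_closed[OF K(1)] by (auto simp: B_def)
    then show "s \<in> (\<Union>K\<in>twist_classes D. B K)" using K by blast
  qed (auto simp: B_def)
  moreover have "B K \<inter> B K' = {}" if "K \<in> twist_classes D" "K' \<in> twist_classes D" "K \<noteq> K'" for K K'
  proof (rule ccontr)
    assume "B K \<inter> B K' \<noteq> {}"
    then obtain s where s: "s \<in> sides D" "fst ` part s \<subseteq> K" "fst ` part s \<subseteq> K'"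
      by (auto simp: B_def)
    then obtain p where "p \<in> part s" using sidesD(2) by blast
    then have "fst p \<in> K" "fst p \<in> K'" using s by auto
    then show False using classes_disjoint[OF that] by auto
  qed
  ultimately have b: "card {s \<in> sides D. card (part s) = 2} = (\<Sum>K\<in>twist_classes D. card (B K))"
    using finB by (simp add: card_UN_disjoint)
  have *: "card (B K) + 1 \<le> card K + of_bool (K \<in> full_classes)" if K: "K \<in> twist_classes D" for K
  proof -
    let ?U = "\<Union>s\<in>B K. part s" and ?P = "K \<times> (UNIV :: strand set)"
    have U: "card ?U = 2 * card (B K)"
      using card_Union_parts[of "B K"] by (simp add: B_def)
    have P: "card ?P = 2 * card K" "finite ?P"
      using finite_class[OF K] by (simp_all add: card_cartesian_product)
    have sub: "?U \<subseteq> ?P"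
    proof
      fix p assume "p \<in> ?U"
      then have "fst p \<in> K" unfolding B_def by blast
      then show "p \<in> ?P" by (cases p) simp
    qed
    show ?thesis
    proof (cases "K \<in> full_classes")
      case True
      then show ?thesis using card_mono[OF P(2) sub] U P by simp
    next
      case False
      then obtain p where p: "p \<in> passages D" "fst p \<in> K" "card (part (side_of p)) \<noteq> 2"
        using K by (auto simp: full_classes_def)
      have notin: "p \<notin> ?U" using p(3) side_of_eq[of _ p] unfolding B_def by auto
      have "p \<in> ?P" using p by (cases p) auto
      then have "?U \<noteq> ?P" using notin by metis
      with sub have "?U \<subset> ?P" by (rule psubsetI)
      then have "card ?U < card ?P" by (rule psubset_card_mono[OF P(2)])
      then have "card (B K) < card K" by (simp only: U P(1))
      then show ?thesis by simp
    qed
  qed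
  have "(\<Sum>K\<in>twist_classes D. card (B K) + 1) \<le>
      (\<Sum>K\<in>twist_classes D. card K + of_bool (K \<in> full_classes))"
    by (rule sum_mono) (rule *)
  moreover have "(\<Sum>K\<in>twist_classes D. of_bool (K \<in> full_classes)) = card full_classes"
    by (simp add: full_classes_def Int_def)
  ultimately show ?thesis by (simp add: sum.distrib sum_Suc sum_classes b num_twist_classes_def)
qed

lemma sum_excess:
  "(\<Sum>s\<in>sides D. int (card (part s)) - 3) =
     2 * int (card (crossings D)) - 3 * int (card (circles D)) - 3 * int (card (separating D))"
  using sum_parts by (simp add: sum_subtractf card_sides flip: of_nat_sum)

text \<open>Only bigons have degree below 3, and each of them falls short by 1.\<close>

lemma sum_excess_ge:
  assumes "S \<subseteq> sides D"
  shows "(\<Sum>s\<in>S. int (card (part s)) - 3) \<ge> - int (card {s \<in> S. card (part s) = 2})"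
proof -
  have fin: "finite S" using assms finite_subset by fastforce
  have "- int (card {s \<in> S. card (part s) = 2}) = (\<Sum>s\<in>S. - of_bool (card (part s) = 2))"
    using fin by (simp add: sum_negf Int_def)
  also have "\<dots> \<le> (\<Sum>s\<in>S. int (card (part s)) - 3)"
  proof (rule sum_mono)
    fix s assume "s \<in> S"
    then have "card (part s) \<ge> 2" using assms part_degree_ge by blast
    then show "- of_bool (card (part s) = 2) \<le> int (card (part s)) - 3" by simp
  qed
  finally show ?thesis .
qed

text \<open>Distributing 2 c passages over s + J sides forces at least 3 (s + J) - 2 c bigons, and
  by \<open>card_bigons_le\<close> bigons reduce the number of classes.\<close>

lemma num_twist_classes_le:
  "int (num_twist_classes D) \<le> 3 * int (card (crossings D)) - 3 * int (card (circles D))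
     - 3 * int (card (separating D)) + int (card full_classes)"
  using sum_excess sum_excess_ge[OF order.refl] card_bigons_le by linarith

section \<open>Boundaries of sets of non-Seifert circle regions\<close>

definition ns_regions :: "'c endpoint set set" where
  "ns_regions = top_region D ` crossings D \<union> bottom_region D ` crossings D"

lemma ns_regions_subset: "ns_regions \<subseteq> regions D"
  by (auto simp: ns_regions_def)

lemma finite_ns_regions [simp]: "finite ns_regions"
  by (simp add: ns_regions_def)

lemma corner_in [simp]: "corner i p \<in> ends D \<longleftrightarrow> p \<in> passages D"
  by (auto simp: corner_def passages_fst)

lemma fst_corner [simp]: "fst (fst (corner i p)) = fst p"
  by (simp add: corner_def)

lemma inj_corner: "inj (corner i)"
proof (rule injI)
  fix p q :: "'c passage" assume eq: "corner i p = corner i q"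
  then have "fst p = fst q" by (metis fst_corner)
  moreover have "snd p = snd q" using eq by (cases i) (auto simp: corner_def)
  ultimately show "p = q" by (simp add: prod_eq_iff)
qed

text \<open>Two corners at a crossing are non-Seifert corners. Each of the other two is cut off by a
  Seifert circle and lies on the side of it away from the crossing, whence
  \<open>right_of D p \<noteq> i\<close>.\<close>

lemma endpoint_cases:
  assumes "h \<in> ends D"
  obtains (non_seifert) d where "h = ((fst (fst h), rw (fst (fst h))), d)"
  | (seifert) i p where "p \<in> passages D" "right_of D p \<noteq> i" "h = corner i p"
proof (cases "snd (fst h) = rw (fst (fst h))")
  case True
  then show ?thesis using non_seifert[of "snd h"] by (simp add: prod_eq_iff)
next
  case False
  obtain c s d where h: "h = ((c, s), d)" by (metis surj_pair)
  have s: "s \<noteq> rw c" using False h by simp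
  have cs: "(c, s) \<in> passages D" using assms h by simp
  show ?thesis
  proof (cases d)
    case Incoming
    then show ?thesis using seifert[of "(c, s)" True] h s cs by (simp add: right_of_def corner_def)
  next
    case Outgoing
    then show ?thesis using seifert[of "(c, other s)" False] h s cs
      by (simp add: right_of_def corner_def other_eq_iff)
  qed
qed

lemma ns_corner_in:
  assumes "c \<in> crossings D"
  shows "((c, rw c), Outgoing) \<in> top_region D c" and "((c, rw c), Incoming) \<in> bottom_region D c"
  unfolding top_region_def bottom_region_def
  by (rule in_region_self, simp add: assms passages_def)+

lemma ns_corner_region:
  assumes "((c, rw c), d) \<in> ends D"
  shows "region D ((c, rw c), d) \<in> {top_region D c, bottom_region D c}"
  by (cases d) (simp_all add: top_region_def bottom_region_def)

text \<open>The flank of a circle can change only at a crossing on side \<open>i\<close>, and there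
  it is a non-Seifert circle region. A flank which is none persists along the whole circle and meets
  no crossing on that side.\<close>

lemma side_empty_of_pure:
  assumes p: "p \<in> passages D" and pure: "flank i p \<notin> ns_regions"
  shows "side D i (orbit (seifert_next D) p) = {}"
proof -
  let ?A = "{q \<in> passages D. flank i q = flank i p}"
  have ns: "top_region D (fst q) \<in> ns_regions" "bottom_region D (fst q) \<in> ns_regions"
    if "q \<in> passages D" for q
    using that by (auto simp: ns_regions_def passages_fst)
  have "seifert_next D q \<in> ?A" if q: "q \<in> ?A" for q
  proof (cases i)
    case True
    then have "\<not> right_of D q" using q pure flank_change(1)[of q] ns[of q] by auto
    then show ?thesis using q flank_same(1)[of q] True by simp
  next
    case False
    have "right_of D (seifert_next D q)"
    proof (rule ccontr)
      assume "\<not> right_of D (seifert_next D q)"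
      then have "flank False q = bottom_region D (fst (seifert_next D q))"
        using flank_change(2)[of q] q by blast
      then have "flank False q \<in> ns_regions" using ns(2)[of "seifert_next D q"] q by simp
      then show False using q pure False by auto
    qed
    then show ?thesis using q flank_same(2)[of q] False by simp
  qed
  then have "orbit (seifert_next D) p \<subseteq> ?A"
    using p by (intro orbit_subset_of_closed) auto
  moreover have "right_of D q \<noteq> i" if q: "q \<in> ?A" for q
  proof (cases i)
    case True
    then show ?thesis using q pure flank_change(1)[of q] ns[of q] by auto
  next
    case False
    have top: "flank False q = top_region D (fst q)" if "\<not> right_of D q"
      using out_top[OF that] by (simp add: flank_def corner_def top_region_def)
    have "flank False q \<notin> ns_regions" using q pure False by simp
    then have "right_of D q" using top ns(1)[of q] q by fastforce
    then show ?thesis using False by simp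
  qed
  ultimately show ?thesis by (auto simp: side_def)
qed

text \<open>Without crossings on side \<open>i\<close> the boundary walk of the flanking region
  follows the circle all the way round, forwards on the right and backwards on the left.\<close>

lemma pure_flank:
  assumes C: "C \<in> circles D" and empty: "side D i C = {}" and p: "p \<in> C"
  shows "flank i p = corner i ` C"
proof
  note sub = circle_subset[OF C]
  have not_i: "right_of D q \<noteq> i" if "q \<in> C" for q
    using empty that unfolding side_def by blast
  have next_in: "seifert_next D q \<in> C" if "q \<in> C" for q
    using bij_circle[OF C] that by (auto simp: bij_betw_def)
  have "bd (corner i q) \<in> corner i ` C" if q: "q \<in> C" for q
  proof (cases i)
    case True
    then show ?thesis using bd_inc[of q] not_i[OF q] next_in[OF q]
      by (simp add: corner_def del: o_apply)
  next
    case False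
    have "q \<in> seifert_next D ` C" using bij_circle[OF C] q by (simp add: bij_betw_def)
    then obtain q' where q': "q' \<in> C" "q = seifert_next D q'" by blast
    then have "bd (out q) = out q'" using bd_out[of q'] not_i[OF q] False by simp
    then show ?thesis using q' False by (simp add: corner_def del: o_apply)
  qed
  then show "flank i p \<subseteq> corner i ` C"
    unfolding flank_def region_def using p by (intro orbit_subset_of_closed) blast+
  have const: "flank i q = flank i p" if "q \<in> C" for q
  proof (rule orbit_invariant[of "seifert_next D" C])
    show "seifert_next D ` C \<subseteq> C" using next_in by blast
    show "q \<in> orbit (seifert_next D) p" using circle_eq[OF C p] that by simp
    show "flank i (seifert_next D z) = flank i z" if "z \<in> C" for z
      using flank_same[of z] not_i[OF that] not_i[OF next_in[OF that]] that sub
      by (cases i) auto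
  qed (rule p)
  show "corner i ` C \<subseteq> flank i p"
  proof
    fix h assume "h \<in> corner i ` C"
    then obtain q where q: "q \<in> C" "h = corner i q" by blast
    then have "h \<in> region D (corner i q)"
      using in_region_self[of "corner i q"] sub by (simp only: corner_in subsetD)
    then show "h \<in> flank i p" using const[OF q(1)] by (simp only: flank_def)
  qed
qed

lemma pure_region:
  assumes "r \<in> regions D" and "r \<notin> ns_regions"
  obtains i C where "C \<in> circles D" "side D i C = {}" "r = corner i ` C"
proof -
  obtain h where h: "h \<in> ends D" "r = region D h" using assms(1) by (auto simp: regions_def)
  from h(1) show thesis
  proof (cases rule: endpoint_cases)
    case (non_seifert d)
    then have "fst (fst h) \<in> crossings D" using h(1) by (metis ends_iff fst_conv passages_fst)
    then have "r \<in> ns_regions"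
      using ns_corner_region[of "fst (fst h)" d] h non_seifert
      by (auto simp: ns_regions_def)
    then show thesis using assms(2) by simp
  next
    case (seifert i p)
    then have r: "r = flank i p" using h by (simp add: flank_def)
    then have "side D i (orbit (seifert_next D) p) = {}"
      using side_empty_of_pure seifert(1) assms(2) by simp
    moreover from this have "r = corner i ` orbit (seifert_next D) p"
      using pure_flank r seifert(1) circle_of by simp
    ultimately show thesis by (rule that[OF orbit_in_circles[OF seifert(1)]])
  qed
qed

text \<open>A region without non-Seifert corners fills the empty side of a Seifert circle. A
  separating circle has no empty side, any other exactly one.\<close>

lemma card_pure_regions: "card (regions D - ns_regions) + card (separating D) \<le> card (circles D)"
proof -
  let ?g = "\<lambda>C. corner (side D True C = {}) ` C"
  have "regions D - ns_regions \<subseteq> ?g ` (circles D - separating D)"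
  proof
    fix r assume "r \<in> regions D - ns_regions"
    then obtain i C where C: "C \<in> circles D" "side D i C = {}" "r = corner i ` C"
      using pure_region by blast
    have "side D True C \<noteq> {} \<or> side D False C \<noteq> {}"
      using side_Un[of C] circle_nonempty[OF C(1)] by auto
    then have "(side D True C = {}) = i" using C(2) by (cases i) auto
    then have "r = ?g C" using C(3) by simp
    moreover have "C \<notin> separating D" using C(2) by (cases i) (auto simp: separating_def)
    ultimately show "r \<in> ?g ` (circles D - separating D)" using C(1) by blast
  qed
  then have "card (regions D - ns_regions) \<le> card (circles D - separating D)"
    by (rule surj_card_le[rotated]) simp
  also have "\<dots> = card (circles D) - card (separating D)"
    by (rule card_Diff_subset) (auto simp: separating_def)
  finally show ?thesis
    using card_mono[of "circles D" "separating D"] by (simp add: separating_def)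
qed

lemma card_ns_regions:
  "card (crossings D) + 2 + card (separating D) \<le> card ns_regions + card (circles D)"
proof -
  have "card (regions D - ns_regions) = card (regions D) - card ns_regions"
    using ns_regions_subset by (intro card_Diff_subset) simp_all
  then show ?thesis using card_pure_regions card_regions by linarith
qed

text \<open>Walking round a region, the direction of the ends changes exactly at the non-Seifert
  corners, so every region has an even number of them. In the graph of regions and crossings all
  degrees, hence all cuts, are even.\<close>

lemma even_boundary_cut: "even (card (boundary_cut D y))"
proof -
  let ?A = "{h \<in> ends D. region D h \<in> y}"
  let ?T = "{c \<in> crossings D. top_region D c \<in> y}" and ?B = "{c \<in> crossings D. bottom_region D c \<in> y}"
  have "bij_betw bd ?A ?A"
  proof -
    have "bd h \<in> ?A" if "h \<in> ?A" for h
      using that region_bd[of h] bij_betwE[OF bij_bd] by (simp del: o_apply)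
    then have "bd ` ?A \<subseteq> ?A" by blast
    moreover have "inj_on bd ?A" using bij_bd unfolding bij_betw_def by (rule inj_on_subset[OF conjunct1]) auto
    moreover have "finite ?A" by simp
    ultimately show ?thesis by (simp only: bij_betw_def endo_inj_surj simp_thms)
  qed
  then have even: "even (card {h \<in> ?A. (snd (bd h) = Outgoing) \<noteq> (snd h = Outgoing)})"
    by (intro even_card_changes) simp
  have "{h \<in> ?A. (snd (bd h) = Outgoing) \<noteq> (snd h = Outgoing)} =
      (\<lambda>c. ((c, rw c), Outgoing)) ` ?T \<union> (\<lambda>c. ((c, rw c), Incoming)) ` ?B" (is "?L = ?R")
  proof (rule set_eqI)
    fix h :: "'c endpoint"
    obtain c s d where h: "h = ((c, s), d)" by (metis surj_pair)
    show "h \<in> ?L \<longleftrightarrow> h \<in> ?R"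
      unfolding h by (cases d; cases "s = rw c")
        (auto simp: top_region_def bottom_region_def passages_def)
  qed
  then have "card ?L = card ?R" by (simp only:)
  moreover have "card ?R = card ?T + card ?B"
    by (subst card_Un_disjoint) (auto simp: card_image inj_on_def)
  moreover have "card ?T + card ?B = card (?T \<union> ?B) + card (?T \<inter> ?B)"
    by (rule card_Un_Int) auto
  \<comment> \<open>The cut is the symmetric difference of \<open>?T\<close> and \<open>?B\<close>,
    so its size has the parity of \<open>card ?T + card ?B\<close>.\<close>
  moreover have "card (?T \<union> ?B) = card (boundary_cut D y) + card (?T \<inter> ?B)"
  proof -
    have "?T \<union> ?B = boundary_cut D y \<union> (?T \<inter> ?B)" by (auto simp: boundary_cut_def)
    moreover have "card \<dots> = card (boundary_cut D y) + card (?T \<inter> ?B)"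
      by (rule card_Un_disjoint) (auto simp: boundary_cut_def)
    ultimately show ?thesis by simp
  qed
  ultimately have "card {h \<in> ?A. (snd (bd h) = Outgoing) \<noteq> (snd h = Outgoing)} =
      card (boundary_cut D y) + 2 * card (?T \<inter> ?B)"
    by linarith
  then show ?thesis using even by simp
qed

section \<open>Balanced cuts in irreducible diagrams\<close>

definition single_crossings :: "'c set" where
  "single_crossings = {c \<in> crossings D. {c} \<in> twist_classes D}"

lemma single_iff: "(c, c') \<in> twist_equiv D \<Longrightarrow> c \<in> single_crossings \<longleftrightarrow> c' \<in> single_crossings"
proof -
  assume eq: "(c, c') \<in> twist_equiv D"
  have "c = c'" if "{c} \<in> twist_classes D" using class_closed[OF that eq] by simp
  moreover have "c = c'" if "{c'} \<in> twist_classes D" using class_closed[OF that eq] by simp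
  ultimately show ?thesis by (auto simp: single_crossings_def)
qed

text \<open>In an irreducible diagram a class is a single crossing or a pair, so a union of classes
  without single crossings consists of pairs.\<close>

lemma even_card_doubles:
  assumes irr: "t2_irreducible D" and X: "X \<subseteq> crossings D"
    and closed: "\<And>c c'. (c, c') \<in> twist_equiv D \<Longrightarrow> c \<in> X \<Longrightarrow> c' \<in> X"
    and single: "X \<inter> single_crossings = {}"
  shows "even (card X)"
proof -
  let ?F = "{K \<in> twist_classes D. K \<subseteq> X}"
  have "X \<subseteq> \<Union> ?F"
  proof
    fix c assume c: "c \<in> X"
    then obtain K where K: "K \<in> twist_classes D" "c \<in> K" using Union_classes X by blast
    have "K \<subseteq> X"
    proof
      fix c' assume "c' \<in> K"
      then have "(c, c') \<in> twist_equiv D"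
        using K quotient_eq_iff[OF equiv_twist] unfolding twist_classes_def by metis
      then show "c' \<in> X" using closed c by blast
    qed
    then show "c \<in> \<Union> ?F" using K by blast
  qed
  then have Un: "\<Union> ?F = X" by blast
  have two: "card K = 2" if K: "K \<in> ?F" for K
  proof -
    have "card K \<le> 2" using irr K by (simp add: t2_irreducible_def)
    moreover have "card K \<noteq> 0" using K finite_class[of K] class_nonempty[of K] by simp
    moreover have "card K \<noteq> 1"
    proof
      assume "card K = 1"
      then obtain c where "K = {c}" by (rule card_1_singletonE)
      then show False using K single X by (auto simp: single_crossings_def)
    qed
    ultimately show ?thesis by linarith
  qed
  have "2 * card ?F = card (\<Union> ?F)"
  proof (rule card_partition)
    show "finite (\<Union> ?F)" using Un X finite_crossings finite_subset by metis
    show "K \<inter> K' = {}" if "K \<in> ?F" "K' \<in> ?F" "K \<noteq> K'" for K K'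
      using classes_disjoint that by blast
  qed (simp_all add: two)
  then show ?thesis using Un by (metis even_mult_iff even_numeral)
qed

definition balanced :: "'c set \<Rightarrow> bool" where
  "balanced Z \<longleftrightarrow> (\<forall>r\<in>regions D. even (card {h \<in> r. fst (fst h) \<in> Z}))"

lemma boundary_cut_equiv:
  assumes "(c, c') \<in> twist_equiv D" and "c \<in> boundary_cut D y"
  shows "c' \<in> boundary_cut D y"
  using assms by (auto simp: twist_equiv_def boundary_cut_def non_seifert_regions_eq doubleton_eq_iff)

text \<open>The corners of a region without non-Seifert corners run once along a circle with all its
  crossings on the other side, so \<open>even_side\<close> counts them. To any other region the
  crossings of the cut contribute non-Seifert corners only, and these come in pairs by
  irreducibility.\<close>

lemma balanced_boundary_cut:
  assumes irr: "t2_irreducible D"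
    and single: "boundary_cut D y \<inter> single_crossings = {}"
    and sep: "\<And>C p. C \<in> separating D \<Longrightarrow> p \<in> C \<Longrightarrow> fst p \<notin> boundary_cut D y"
  shows "balanced (boundary_cut D y)"
  unfolding balanced_def
proof
  fix r assume r: "r \<in> regions D"
  let ?Z = "boundary_cut D y"
  show "even (card {h \<in> r. fst (fst h) \<in> ?Z})"
  proof (cases "r \<in> ns_regions")
    case False
    then obtain i C where C: "C \<in> circles D" "side D i C = {}" "r = corner i ` C"
      using pure_region r by blast
    have "{h \<in> r. fst (fst h) \<in> ?Z} = corner i ` {p \<in> C. fst p \<in> ?Z}"
      unfolding C(3) by (auto simp: image_iff)
    also have "card \<dots> = card {p \<in> C. fst p \<in> ?Z}"
      by (rule card_image[OF inj_on_subset[OF inj_corner]]) simp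
    also have "side D (\<not> i) C = C" using C(2) side_Un[of C] by (cases i) auto
    then have "even (card {p \<in> C. fst p \<in> ?Z})" using even_side[OF C(1), of "\<not> i" y] by simp
    finally show ?thesis .
  next
    case True
    let ?X = "{c \<in> ?Z. r \<in> {top_region D c, bottom_region D c}}"
    let ?S = "{h \<in> r. fst (fst h) \<in> ?Z}"
    \<comment> \<open>Crossings of the cut lie on non-separating circles only. Were \<open>h\<close>
      a corner cut off by such a circle, the side containing it would be empty and \<open>r\<close>
      would have no non-Seifert corner, against \<open>True\<close>.\<close>
    have ns: "h = ((fst (fst h), rw (fst (fst h))), snd h) \<and> fst (fst h) \<in> ?X" if h: "h \<in> ?S" for h
    proof -
      have hD: "h \<in> ends D" "region D h = r"
        using h r regions_subset in_region_iff by blast+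
      from hD(1) show ?thesis
      proof (cases rule: endpoint_cases)
        case (non_seifert d)
        then have "r \<in> {top_region D (fst (fst h)), bottom_region D (fst (fst h))}"
          using ns_corner_region[of "fst (fst h)" d] hD by metis
        moreover have "h = ((fst (fst h), rw (fst (fst h))), snd h)"
          using non_seifert by (metis snd_conv)
        ultimately show ?thesis using h by blast
      next
        case (seifert i p)
        let ?C = "orbit (seifert_next D) p"
        have pC: "?C \<in> circles D" "p \<in> ?C" using seifert(1) circle_of by auto
        have "fst p \<in> ?Z" using h seifert(3) by (cases i) auto
        then have "?C \<notin> separating D" using sep pC by blast
        moreover have "p \<in> side D (\<not> i) ?C" using pC(2) seifert(2) by (simp add: side_def)
        ultimately have empty: "side D i ?C = {}"
          using pC(1) by (cases i) (auto simp: separating_def)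
        then have req: "r = corner i ` ?C"
          using pure_flank[OF pC(1) empty pC(2)] hD(2) seifert(3) by (simp add: flank_def)
        obtain c d where c: "c \<in> crossings D" "((c, rw c), d) \<in> r"
          using True ns_corner_in unfolding ns_regions_def by blast
        then obtain q where q: "q \<in> ?C" "((c, rw c), d) = corner i q" using req by blast
        have "right_of D q = i" using q(2) by (cases i) (auto simp: corner_def right_of_def)
        then have "q \<in> side D i ?C" using q(1) by (simp add: side_def)
        then show ?thesis by (simp only: empty empty_iff)
      qed
    qed
    \<comment> \<open>The two non-Seifert corners of a crossing are never both in \<open>r\<close>,
      as its top and bottom regions differ; so counting corners amounts to counting
      crossings.\<close>
    have "inj_on (\<lambda>h. fst (fst h)) ?S"
    proof (rule inj_onI)
      fix h k assume hk: "h \<in> ?S" "k \<in> ?S" "fst (fst h) = fst (fst k)"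
      let ?c = "fst (fst h)"
      have eqs: "h = ((?c, rw ?c), snd h)" "k = ((?c, rw ?c), snd k)"
        using ns[OF hk(1)] ns[OF hk(2)] hk(3) by metis+
      have "region D h = r" "region D k = r" "?c \<in> crossings D"
        using hk r regions_subset in_region_iff by (blast, blast, auto simp: boundary_cut_def)
      then have "snd h = snd k"
        using top_neq_bottom[of ?c] eqs unfolding top_region_def bottom_region_def
        by (metis (full_types) direction.exhaust)
      then show "h = k" using eqs by simp
    qed
    then have "card ?S = card ((\<lambda>h. fst (fst h)) ` ?S)" by (simp add: card_image)
    also have "(\<lambda>h. fst (fst h)) ` ?S = ?X"
    proof
      show "(\<lambda>h. fst (fst h)) ` ?S \<subseteq> ?X" using ns by blast
      show "?X \<subseteq> (\<lambda>h. fst (fst h)) ` ?S"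
      proof
        fix c assume c: "c \<in> ?X"
        then have "c \<in> crossings D" by (simp add: boundary_cut_def)
        then obtain d where "((c, rw c), d) \<in> r"
          using c ns_corner_in[of c] by auto
        then show "c \<in> (\<lambda>h. fst (fst h)) ` ?S" using c by force
      qed
    qed
    also have "even (card ?X)"
    proof (rule even_card_doubles[OF irr])
      show "?X \<subseteq> crossings D" by (auto simp: boundary_cut_def)
      show "?X \<inter> single_crossings = {}" using single by blast
      fix c c' assume eq: "(c, c') \<in> twist_equiv D" and c: "c \<in> ?X"
      have "r \<in> {top_region D c, bottom_region D c}" "c \<in> ?Z" using c by blast+
      moreover have "{top_region D c, bottom_region D c} = {top_region D c', bottom_region D c'}"
        using eq by (simp add: twist_equiv_def non_seifert_regions_eq)
      ultimately show "c' \<in> ?X" using boundary_cut_equiv[OF eq] by blast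
    qed
    finally show ?thesis .
  qed
qed

section \<open>Lower bound for the number of components\<close>

definition components :: "'c passage set set" where
  "components = orbit (next_passage D) ` passages D"

lemma finite_components [simp]: "finite components"
  by (simp add: components_def)

definition even_unions :: "'c endpoint set set set" where
  "even_unions = {u \<in> Pow (regions D). \<forall>c\<in>crossings D. even (card {h \<in> ends_at c. region D h \<in> u})}"

lemma finite_ends_at [simp]: "finite (ends_at c)"
  by (simp add: ends_at_def finite_cartesian_product)

lemma ends_at_eq:
  assumes "fst (fst h) = c"
  shows "ends_at c = {h, rot D h, rot D (rot D h), rot D (rot D (rot D h))}"
proof -
  obtain s d where h: "h = ((c, s), d)" using assms by (cases h; cases "fst h") auto
  show ?thesis unfolding h
    by (cases s; cases d; cases "rw c") (auto simp: ends_at_def UNIV_strand UNIV_direction)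
qed

lemma region_rot: "h \<in> ends D \<Longrightarrow> region D (rot D (rot D (rot D h))) = region D (across D h)"
  using region_bd[of "rot D (rot D (rot D h))"] by simp

text \<open>
  An even union of regions has a boundary consisting of whole components: an edge lies on the
  boundary iff the regions of its two ends (each read as a corner) are separated.
\<close>

definition jump :: "'c endpoint set set \<Rightarrow> 'c passage \<Rightarrow> bool" where
  "jump u p \<longleftrightarrow> (region D (p, Outgoing) \<in> u) \<noteq> (region D (next_passage D p, Incoming) \<in> u)"

text \<open>The four corners at the crossing are the two beside the entering edge and the two beside
  the leaving edge. As the regions of an even number of them are in \<open>u\<close>, the two jumps
  agree.\<close>

lemma jump_next:
  assumes u: "u \<in> even_unions" and p: "p \<in> passages D"
  shows "jump u (next_passage D p) = jump u p"
proof -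
  let ?q = "next_passage D p"
  let ?S = "{h \<in> ends_at (fst ?q). region D h \<in> u}"
  obtain c s where cs: "?q = (c, s)" by fastforce
  have q: "?q \<in> passages D" using p by simp
  have sum4: "(\<Sum>h\<in>{h1, h2, h3, h4}. f h) = f h1 + (f h2 + (f h3 + f h4))"
    if "distinct [h1, h2, h3, h4]" for h1 h2 h3 h4 :: "'c endpoint" and f :: "'c endpoint \<Rightarrow> nat"
    using that by simp
  let ?h = "(?q, Incoming)" and ?k = "(?q, Outgoing)"
  let ?h' = "rot D (rot D (rot D ?h))" and ?k' = "rot D (rot D (rot D ?k))"
  have dist: "distinct [?h, ?k, ?h', ?k']" "ends_at c = {?h, ?k, ?h', ?k'}"
    unfolding cs by (cases s; cases "rw c"; auto simp: ends_at_def UNIV_strand UNIV_direction)+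
  have "c \<in> crossings D" using q cs by (simp add: passages_fst)
  then have "even (\<Sum>h\<in>ends_at c. of_bool (region D h \<in> u) :: nat)"
    using u by (simp add: even_unions_def Int_def)
  then have "even (of_bool (region D ?h \<in> u) + (of_bool (region D ?k \<in> u) +
      (of_bool (region D ?h' \<in> u) + of_bool (region D ?k' \<in> u))) :: nat)"
    unfolding dist(2) sum4[OF dist(1)] .
  moreover have "region D ?h' = region D (p, Outgoing)" 
    using region_rot[of ?h] q by simp
  moreover have "region D ?k' = region D (next_passage D ?q, Incoming)"
    using region_rot[of ?k] q by simp
  ultimately show ?thesis unfolding jump_def by (auto split: if_splits simp del: rot.simps)
qed

text \<open>\<open>\<phi>\<close> records the components bounding \<open>u\<close>. Without
  boundary, membership in \<open>u\<close> is constant across each edge and around each crossing, so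
  by connectedness \<open>u\<close> is empty or contains all regions.\<close>

lemma card_even_unions: "card even_unions \<le> 2 ^ (card components + 1)"
proof -
  define \<phi> where "\<phi> u = {Q \<in> components. \<exists>p\<in>Q. jump u p}" for u
  have fin: "finite even_unions"
    by (rule finite_subset[of _ "Pow (regions D)"]) (auto simp: even_unions_def)
  have sym: "sym_diff u v \<in> even_unions" if uv: "u \<in> even_unions" "v \<in> even_unions" for u v
  proof -
    have "even (card {h \<in> ends_at c. region D h \<in> sym_diff u v})" if c: "c \<in> crossings D" for c
    proof -
      let ?U = "{h \<in> ends_at c. region D h \<in> u}" and ?V = "{h \<in> ends_at c. region D h \<in> v}"
      have "card ?U + card ?V = card (?U \<union> ?V) + card (?U \<inter> ?V)"
        by (rule card_Un_Int) auto
      moreover have "?U \<union> ?V = {h \<in> ends_at c. region D h \<in> sym_diff u v} \<union> (?U \<inter> ?V)" by blast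
      moreover have "card \<dots> = card {h \<in> ends_at c. region D h \<in> sym_diff u v} + card (?U \<inter> ?V)"
        by (rule card_Un_disjoint) auto
      ultimately have "card ?U + card ?V =
          card {h \<in> ends_at c. region D h \<in> sym_diff u v} + 2 * card (?U \<inter> ?V)"
        by presburger
      moreover have "even (card ?U)" "even (card ?V)" using uv c by (auto simp: even_unions_def)
      ultimately show ?thesis by presburger
    qed
    then show ?thesis using uv by (auto simp: even_unions_def)
  qed
  have jump_sym: "jump (sym_diff u v) p \<longleftrightarrow> jump u p \<noteq> jump v p" for u v p
    by (auto simp: jump_def)
  have const: "jump u q = jump u p"
    if "u \<in> even_unions" "p \<in> passages D" "q \<in> orbit (next_passage D) p" for u p q
  proof (rule orbit_invariant[OF _ that(2) _ that(3)])
    show "next_passage D ` passages D \<subseteq> passages D" using bij_next by (simp add: bij_betw_def)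
  qed (rule jump_next[OF that(1)])
  have \<phi>_iff: "orbit (next_passage D) p \<in> \<phi> u \<longleftrightarrow> jump u p"
    if "u \<in> even_unions" "p \<in> passages D" for u p
  proof
    assume "orbit (next_passage D) p \<in> \<phi> u"
    then obtain q where "q \<in> orbit (next_passage D) p" "jump u q" unfolding \<phi>_def by blast
    then show "jump u p" using const[OF that] by simp
  next
    assume "jump u p"
    moreover have "p \<in> orbit (next_passage D) p"
      by (rule orbit_self[OF finite_passages bij_next that(2)])
    moreover have "orbit (next_passage D) p \<in> components" using that(2) by (simp add: components_def)
    ultimately show "orbit (next_passage D) p \<in> \<phi> u" unfolding \<phi>_def by blast
  qed
  have "card even_unions \<le> card (Pow components) * 2"
  proof (rule card_le_card_kernel[where \<phi> = \<phi>, OF fin sym])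
    fix u v assume uv: "u \<in> even_unions" "v \<in> even_unions"
    show "\<phi> (sym_diff u v) = sym_diff (\<phi> u) (\<phi> v)"
    proof (rule set_eqI)
      fix Q
      show "Q \<in> \<phi> (sym_diff u v) \<longleftrightarrow> Q \<in> sym_diff (\<phi> u) (\<phi> v)"
      proof (cases "Q \<in> components")
        case True
        then obtain p where p: "p \<in> passages D" "Q = orbit (next_passage D) p"
          by (auto simp: components_def)
        show ?thesis unfolding p(2)
          using \<phi>_iff[OF uv(1) p(1)] \<phi>_iff[OF uv(2) p(1)] \<phi>_iff[OF sym[OF uv] p(1)] jump_sym[of u v p]
          by auto
      qed (simp add: \<phi>_def)
    qed
  next
    have "u = {} \<or> u = regions D" if u: "u \<in> even_unions" "\<phi> u = {}" for u
    proof -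
      have no_jump: "\<not> jump u p" if "p \<in> passages D" for p
        using \<phi>_iff[OF u(1) that] u(2) by simp
      have across: "region D (across D h) \<in> u \<longleftrightarrow> region D h \<in> u" if h: "h \<in> ends D" for h
      proof (cases "snd h")
        case Outgoing
        then show ?thesis using no_jump[of "fst h"] h by (cases h) (simp add: jump_def)
      next
        case Incoming
        then show ?thesis using no_jump[of "inv (next_passage D) (fst h)"] h
          by (cases h) (simp add: jump_def)
      qed
      have rot3: "region D (rot D (rot D (rot D h))) \<in> u \<longleftrightarrow> region D h \<in> u" if "h \<in> ends D" for h
        using across[OF that] region_rot[OF that] by simp
      have rot1: "region D (rot D h) \<in> u \<longleftrightarrow> region D h \<in> u" if "h \<in> ends D" for h
        using rot3[of "rot D h"] that by (simp del: rot.simps)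
      have same: "region D k \<in> u \<longleftrightarrow> region D h \<in> u"
        if h: "h \<in> ends D" and "fst (fst k) = fst (fst h)" for h k
      proof -
        have "k \<in> ends_at (fst (fst h))" using that by (cases k; cases "fst k") (auto simp: ends_at_def)
        then show ?thesis
          using rot1[of h] rot1[of "rot D h"] rot1[of "rot D (rot D h)"] h
          unfolding ends_at_eq[OF refl] by (auto simp del: rot.simps)
      qed
      let ?Z = "{c \<in> crossings D. region D ((c, Over), Outgoing) \<in> u}"
      have Z: "region D h \<in> u \<longleftrightarrow> fst (fst h) \<in> ?Z" if "h \<in> ends D" for h
        using same[of "((fst (fst h), Over), Outgoing)" h] that
        by (cases h) (simp add: passages_fst)
      have "?Z = {} \<or> ?Z = crossings D"
      proof (rule connected)
        fix p assume p: "p \<in> passages D"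
        show "fst p \<in> ?Z \<longleftrightarrow> fst (next_passage D p) \<in> ?Z"
          using Z[of "(p, Outgoing)"] Z[of "(next_passage D p, Incoming)"] across[of "(p, Outgoing)"] p
          by (simp del: mem_Collect_eq)
      qed blast
      moreover have "fst (fst h) \<in> crossings D" if "h \<in> ends D" for h
        using that by (cases h) (simp add: passages_fst)
      ultimately have "(\<forall>h\<in>ends D. region D h \<notin> u) \<or> (\<forall>h\<in>ends D. region D h \<in> u)"
        using Z by (auto simp del: mem_Collect_eq split_paired_All)
      moreover have "u \<subseteq> regions D" using u(1) by (simp add: even_unions_def)
      ultimately show ?thesis by (auto simp: regions_def)
    qed
    then have "{u \<in> even_unions. \<phi> u = {}} \<subseteq> {{}, regions D}" by blast
    then have "card {u \<in> even_unions. \<phi> u = {}} \<le> card {{}, regions D}"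
      by (rule card_mono[rotated]) simp
    also have "\<dots> \<le> 2" by (simp add: card_insert_if)
    finally show "card {u \<in> even_unions. \<phi> u = {}} \<le> 2" .
  qed (auto simp: \<phi>_def)
  then show ?thesis by (simp add: card_Pow)
qed

text \<open>The matrix \<open>?m\<close> counts the corners of a crossing in a region; its two
  kernels are the even unions and the balanced sets. As there are two more regions than crossings,
  duality makes the even unions four times as many as the balanced sets.\<close>

lemma card_balanced: "2 * card {Z \<in> Pow (crossings D). balanced Z} \<le> 2 ^ card components"
proof -
  let ?m = "\<lambda>c r. card {h \<in> r. fst (fst h) = c}"
  have fin: "finite r" if "r \<in> regions D" for r
    using regions_subset[OF that] finite_ends finite_subset by blast
  have cols: "(\<Sum>c\<in>Z. ?m c r) = card {h \<in> r. fst (fst h) \<in> Z}"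
    if "r \<in> regions D" "Z \<subseteq> crossings D" for r Z
  proof -
    have "card (\<Union>c\<in>Z. {h \<in> r. fst (fst h) = c}) = (\<Sum>c\<in>Z. ?m c r)"
      using that fin finite_subset[OF that(2)] by (intro card_UN_disjoint) auto
    moreover have "(\<Union>c\<in>Z. {h \<in> r. fst (fst h) = c}) = {h \<in> r. fst (fst h) \<in> Z}" by blast
    ultimately show ?thesis by simp
  qed
  have rows: "(\<Sum>r\<in>u. ?m c r) = card {h \<in> ends_at c. region D h \<in> u}"
    if "c \<in> crossings D" "u \<subseteq> regions D" for c u
  proof -
    have "card (\<Union>r\<in>u. {h \<in> r. fst (fst h) = c}) = (\<Sum>r\<in>u. ?m c r)"
    proof (rule card_UN_disjoint)
      show "finite u" by (rule finite_subset[OF that(2) finite_regions])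
      show "\<forall>r\<in>u. finite {h \<in> r. fst (fst h) = c}" using fin that(2) by auto
      show "\<forall>r\<in>u. \<forall>r'\<in>u. r \<noteq> r' \<longrightarrow> {h \<in> r. fst (fst h) = c} \<inter> {h \<in> r'. fst (fst h) = c} = {}"
        using that(2) in_region_iff regions_subset by blast
    qed
    moreover have "(\<Union>r\<in>u. {h \<in> r. fst (fst h) = c}) = {h \<in> ends_at c. region D h \<in> u}"
    proof (intro equalityI subsetI)
      fix h assume "h \<in> (\<Union>r\<in>u. {h \<in> r. fst (fst h) = c})"
      then obtain r where r: "r \<in> u" "h \<in> r" "fst (fst h) = c" by blast
      then have "region D h = r" using that(2) in_region_iff[of h r] regions_subset by blast
      then show "h \<in> {h \<in> ends_at c. region D h \<in> u}"
        using r by (cases h; cases "fst h") (simp add: ends_at_def)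
    next
      fix h assume h: "h \<in> {h \<in> ends_at c. region D h \<in> u}"
      then have "fst (fst h) = c" by (auto simp: ends_at_def)
      moreover from this have "h \<in> region D h"
        using that(1) by (intro in_region_self) (simp add: ends_def passages_fst mem_Times_iff)
      ultimately show "h \<in> (\<Union>r\<in>u. {h \<in> r. fst (fst h) = c})" using h by blast
    qed
    ultimately show ?thesis by simp
  qed
  have "{u \<in> Pow (regions D). \<forall>c\<in>crossings D. even (\<Sum>r\<in>u. ?m c r)} = even_unions"
    unfolding even_unions_def using rows by auto
  moreover have "{Z \<in> Pow (crossings D). \<forall>r\<in>regions D. even (\<Sum>c\<in>Z. ?m c r)} =
      {Z \<in> Pow (crossings D). balanced Z}"
    unfolding balanced_def using cols by auto
  ultimately have "2 ^ card (crossings D) * card even_unions =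
      2 ^ card (regions D) * card {Z \<in> Pow (crossings D). balanced Z}"
    using card_kernel_transpose[of "crossings D" "regions D" ?m] by simp
  then have "card even_unions = 4 * card {Z \<in> Pow (crossings D). balanced Z}"
    by (simp add: card_regions power_add)
  then show ?thesis using card_even_unions by simp
qed

section \<open>Counting constraints on boundary cuts\<close>

lemma boundary_cut_sym_diff:
  "boundary_cut D (sym_diff y z) = sym_diff (boundary_cut D y) (boundary_cut D z)"
  by (auto simp: boundary_cut_def)

text \<open>A set \<open>y\<close> with empty cut is determined by the crossings whose top region,
  equivalently bottom region, lies in it. As the flank never enters or leaves \<open>y\<close> along
  a circle, these crossings form a closed set.\<close>

lemma card_cut_kernel:
  "card {y \<in> Pow ns_regions. boundary_cut D y = {}} \<le> 2 ^ (card (separating D) + 1)"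
proof -
  let ?G = "{y \<in> Pow ns_regions. boundary_cut D y = {}}"
  let ?f = "\<lambda>y. {c \<in> crossings D. top_region D c \<in> y}"
  have tb: "top_region D c \<in> y \<longleftrightarrow> bottom_region D c \<in> y"
    if "y \<in> ?G" "c \<in> crossings D" for y c
    using that by (auto simp: boundary_cut_def)
  have "inj_on ?f ?G"
  proof (rule inj_onI)
    fix y z assume y: "y \<in> ?G" and z: "z \<in> ?G" and eq: "?f y = ?f z"
    then have "top_region D c \<in> y \<longleftrightarrow> top_region D c \<in> z" if "c \<in> crossings D" for c
      using that by blast
    then have "r \<in> y \<longleftrightarrow> r \<in> z" if "r \<in> ns_regions" for r
      using that tb[OF y] tb[OF z] by (auto simp: ns_regions_def)
    then show "y = z" using y z by blast
  qed
  moreover have "side_closed (?f y)" if y: "y \<in> ?G" for y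
    unfolding side_closed_def
  proof (intro conjI ballI)
    fix s p q assume s: "s \<in> sides D" and pq: "p \<in> part s" "q \<in> part s"
    note C = sidesD(1)[OF s]
    define i where "i = fst s"
    have cut: "fst p \<notin> boundary_cut D y" for p using y by simp
    have step: "flank i (seifert_next D x) \<in> y \<longleftrightarrow> flank i x \<in> y" if x: "x \<in> snd s" for x
    proof -
      have xP: "x \<in> passages D" using x circle_subset[OF C] by blast
      show ?thesis
      proof (cases i)
        case True
        then show ?thesis
          using flank_same(1)[OF xP] flank_change(1)[OF xP] tb[OF y, of "fst x"] xP
          by (cases "right_of D x") (auto simp: passages_fst)
      next
        case False
        then show ?thesis
          using flank_same(2)[OF xP] flank_change(2)[OF xP] seifert_in[OF xP]
            tb[OF y, of "fst (seifert_next D x)"]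
          by (cases "right_of D (seifert_next D x)") (auto simp: passages_fst)
      qed
    qed
    have eq: "top_region D (fst x) \<in> y \<longleftrightarrow> flank i x \<in> y" if x: "x \<in> part s" for x
    proof -
      have xP: "x \<in> passages D" using x part_subset[OF s] by blast
      have r: "right_of D x = i" using x by (simp add: side_def i_def)
      show ?thesis
      proof (cases i)
        case True
        then show ?thesis using flank_change(1)[OF xP] tb[OF y, of "fst x"] xP r
          by (simp add: passages_fst)
      next
        case False
        then show ?thesis using out_top[of x] r by (simp add: flank_def corner_def top_region_def)
      qed
    qed
    have "flank i q \<in> y \<longleftrightarrow> flank i p \<in> y"
    proof (rule orbit_invariant[of "seifert_next D" "snd s" p "\<lambda>x. flank i x \<in> y"])
      show "seifert_next D ` snd s \<subseteq> snd s" using bij_circle[OF C] by (simp add: bij_betw_def)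
      show "p \<in> snd s" using pq by (simp add: side_def)
      then show "q \<in> orbit (seifert_next D) p"
        using circle_eq[OF C, of p] pq(2) by (simp add: side_def)
    qed (rule step)
    moreover have "fst p \<in> crossings D" "fst q \<in> crossings D"
      using pq part_subset[OF s] passages_fst by blast+
    ultimately show "fst p \<in> ?f y \<longleftrightarrow> fst q \<in> ?f y" using eq pq by simp
  qed blast
  moreover have "finite {Z. side_closed Z}"
    by (rule finite_subset[of _ "Pow (crossings D)"]) (auto simp: side_closed_def)
  ultimately have "card ?G \<le> card {Z. side_closed Z}"
    by (intro card_inj_on_le[of ?f]) auto
  then show ?thesis using card_side_closed by simp
qed

text \<open>Two kernel counts: restricting to sets of regions whose cut avoids \<open>S\<close>
  costs at most |S| dimensions, and since the remaining cuts are balanced, at most (n - 1) + (J + 1)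
  dimensions are left. There are at least c + 2 + J - s non-Seifert circle regions to start
  with.\<close>

lemma components_bound:
  assumes S: "S \<subseteq> crossings D"
    and bal: "\<And>y. boundary_cut D y \<inter> S = {} \<Longrightarrow> balanced (boundary_cut D y)"
  shows "card (crossings D) + 2 \<le> card (circles D) + card S + card components"
proof -
  let ?G = "{y \<in> Pow ns_regions. boundary_cut D y \<inter> S = {}}"
  let ?B = "{Z \<in> Pow (crossings D). balanced Z}"
  have "card ?G \<le> card ?B * 2 ^ (card (separating D) + 1)"
  proof (rule card_le_card_kernel[where \<phi> = "boundary_cut D"])
    have "{x \<in> ?G. boundary_cut D x = {}} = {y \<in> Pow ns_regions. boundary_cut D y = {}}" by auto
    then show "card {x \<in> ?G. boundary_cut D x = {}} \<le> 2 ^ (card (separating D) + 1)"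
      using card_cut_kernel by simp
    show "boundary_cut D ` ?G \<subseteq> ?B" using bal by (auto simp: boundary_cut_def)
    show "sym_diff x y \<in> ?G" if "x \<in> ?G" "y \<in> ?G" for x y
      using that unfolding mem_Collect_eq boundary_cut_sym_diff by blast
  qed (simp_all add: boundary_cut_sym_diff)
  also have "\<dots> = (2 * card ?B) * 2 ^ card (separating D)" by (simp only: power_add power_one_right ac_simps)
  also have "\<dots> \<le> 2 ^ card components * 2 ^ card (separating D)"
    by (rule mult_le_mono1[OF card_balanced])
  finally have G: "card ?G \<le> 2 ^ card components * 2 ^ card (separating D)" .
  have "card (Pow ns_regions) \<le> card (Pow S) * card ?G"
  proof (rule card_le_card_kernel[where \<phi> = "\<lambda>y. boundary_cut D y \<inter> S"])
    show "boundary_cut D (sym_diff x y) \<inter> S =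
        sym_diff (boundary_cut D x \<inter> S) (boundary_cut D y \<inter> S)" for x y
      unfolding boundary_cut_sym_diff by blast
    show "finite (Pow S)" using finite_subset[OF S] by simp
  qed auto
  also have "\<dots> \<le> 2 ^ card S * (2 ^ card components * 2 ^ card (separating D))"
    using G finite_subset[OF S] by (simp add: card_Pow)
  finally have "(2::nat) ^ card ns_regions \<le> 2 ^ (card S + card components + card (separating D))"
    by (simp add: card_Pow power_add ac_simps)
  then have "card ns_regions \<le> card S + card components + card (separating D)"
    by (rule power_le_imp_le_exp[rotated]) simp
  then show ?thesis using card_ns_regions by linarith
qed

definition separating_sides :: "(bool \<times> 'c passage set) set" where
  "separating_sides = {s \<in> sides D. snd s \<in> separating D}"

lemma separating_sides_subset: "separating_sides \<subseteq> sides D"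
  by (auto simp: separating_sides_def)

lemma card_separating_sides: "card separating_sides = 2 * card (separating D)"
proof -
  have "separating_sides = UNIV \<times> separating D"
  proof (rule set_eqI)
    show "s \<in> separating_sides \<longleftrightarrow> s \<in> UNIV \<times> separating D" for s
      by (cases s; cases "fst s") (auto simp: separating_sides_def sides_def separating_def)
  qed
  then show ?thesis by (simp add: card_cartesian_product)
qed

lemma even_card_single_cut:
  assumes "t2_irreducible D"
  shows "even (card (single_crossings \<inter> boundary_cut D y))"
proof -
  let ?Z = "boundary_cut D y"
  have sub: "?Z \<subseteq> crossings D" by (auto simp: boundary_cut_def)
  have "even (card (?Z - single_crossings))"
  proof (rule even_card_doubles[OF assms])
    show "c' \<in> ?Z - single_crossings"
      if "(c, c') \<in> twist_equiv D" "c \<in> ?Z - single_crossings" for c c'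
      using that boundary_cut_equiv[of c c' y] single_iff[of c c'] by blast
  qed (use sub in auto)
  moreover have "card ?Z = card (single_crossings \<inter> ?Z) + card (?Z - single_crossings)"
    using card_Int_Diff[OF finite_subset[OF sub finite_crossings], of single_crossings]
    by (simp add: Int_commute)
  ultimately show ?thesis using even_boundary_cut[of y] by presburger
qed

lemma even_card_subset_singleton:
  assumes "even (card X)" and "X \<subseteq> {a}"
  shows "X = {}"
  using assms by (auto simp: subset_singleton_iff)

text \<open>
  One crossing of each kind may be left out of the set of constraints, because the number of
  violated ones is even.
\<close>

lemma card_components_ge:
  assumes irr: "t2_irreducible D"
  shows "card (crossings D) + 2 \<le> card (circles D) +
    ((card single_crossings - 1) + (\<Sum>s\<in>separating_sides. card (part s) - 1)) + card components"
proof -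
  \<comment> \<open>Without single crossings \<open>c0\<close> is arbitrary, but then
    \<open>S1\<close> is empty, in accordance with the truncated subtraction in the claim.
    Separating sides are nonempty, so there \<open>p0\<close> chooses a member.\<close>
  define c0 where "c0 = (SOME c. c \<in> single_crossings)"
  define p0 where "p0 s = (SOME p. p \<in> part s)" for s
  define S1 where "S1 = single_crossings - {c0}"
  define S2 where "S2 = (\<Union>s\<in>separating_sides. fst ` (part s - {p0 s}))"
  have fin: "finite single_crossings" "finite separating_sides"
    using finite_subset[OF separating_sides_subset] by (auto simp: single_crossings_def)
  have part: "finite (part s)" "part s \<noteq> {}" "part s \<subseteq> passages D" if "s \<in> separating_sides" for s
    using that finite_part[of s] sidesD(2)[of s] part_subset[of s] separating_sides_subset by blast+
  have "card S1 \<le> card single_crossings - 1"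
  proof (cases "single_crossings = {}")
    case False
    then have "c0 \<in> single_crossings" unfolding c0_def by (simp add: some_in_eq)
    then show ?thesis using fin by (simp add: S1_def)
  qed (simp add: S1_def)
  moreover have "card S2 \<le> (\<Sum>s\<in>separating_sides. card (part s) - 1)"
  proof -
    have "card S2 \<le> (\<Sum>s\<in>separating_sides. card (fst ` (part s - {p0 s})))"
      unfolding S2_def by (rule card_UN_le[OF fin(2)])
    also have "\<dots> \<le> (\<Sum>s\<in>separating_sides. card (part s) - 1)"
    proof (rule sum_mono)
      fix s assume s: "s \<in> separating_sides"
      have "p0 s \<in> part s" unfolding p0_def using part(2)[OF s] by (simp only: some_in_eq) simp
      then have "card (part s - {p0 s}) = card (part s) - 1"
        using part(1)[OF s] by simp
      then show "card (fst ` (part s - {p0 s})) \<le> card (part s) - 1"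
        using card_image_le[of "part s - {p0 s}" fst] part(1)[OF s] by simp
    qed
    finally show ?thesis .
  qed
  moreover have "card (S1 \<union> S2) \<le> card S1 + card S2" by (rule card_Un_le)
  moreover have "card (crossings D) + 2 \<le> card (circles D) + card (S1 \<union> S2) + card components"
  proof (rule components_bound)
    have "fst p \<in> crossings D" if "s \<in> separating_sides" "p \<in> part s" for s p
      using part(3)[OF that(1)] that(2) passages_fst by blast
    then show "S1 \<union> S2 \<subseteq> crossings D"
      by (auto simp: S1_def S2_def single_crossings_def simp del: split_paired_All)
    fix y assume y: "boundary_cut D y \<inter> (S1 \<union> S2) = {}"
    show "balanced (boundary_cut D y)"
    proof (rule balanced_boundary_cut[OF irr])
      have "single_crossings \<inter> boundary_cut D y \<subseteq> {c0}" using y by (auto simp: S1_def)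
      then have "single_crossings \<inter> boundary_cut D y = {}"
        by (rule even_card_subset_singleton[OF even_card_single_cut[OF irr]])
      then show "boundary_cut D y \<inter> single_crossings = {}" by blast
      fix C p assume C: "C \<in> separating D" and p: "p \<in> C"
      let ?s = "(right_of D p, C)"
      have CC: "C \<in> circles D" using C by (simp add: separating_def)
      have ps: "p \<in> side D (right_of D p) C" using p by (simp add: side_def)
      then have s: "?s \<in> separating_sides" "p \<in> part ?s"
        using C CC by (auto simp: separating_sides_def sides_def)
      have "{q \<in> part ?s. fst q \<in> boundary_cut D y} \<subseteq> {p0 ?s}"
      proof
        fix q assume q: "q \<in> {q \<in> part ?s. fst q \<in> boundary_cut D y}"
        then have "fst q \<notin> S2" using y by blast
        then have "q \<notin> part ?s - {p0 ?s}" using s(1) unfolding S2_def by blast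
        then show "q \<in> {p0 ?s}" using q by blast
      qed
      moreover have "even (card {q \<in> part ?s. fst q \<in> boundary_cut D y})"
        using even_side[OF CC] by simp
      ultimately have "{q \<in> part ?s. fst q \<in> boundary_cut D y} = {}"
        by (rule even_card_subset_singleton[rotated])
      then show "fst p \<notin> boundary_cut D y" using s(2) by blast
    qed
  qed
  ultimately show ?thesis by linarith
qed

lemma card_single_crossings:
  assumes "t2_irreducible D"
  shows "card (crossings D) + card single_crossings = 2 * num_twist_classes D"
proof -
  let ?F = "{K \<in> twist_classes D. card K = 1}"
  have "(\<lambda>c. {c}) ` single_crossings = ?F"
  proof (intro equalityI subsetI)
    fix K assume K: "K \<in> ?F"
    then obtain c where "K = {c}" using card_1_singletonE by blast
    then show "K \<in> (\<lambda>c. {c}) ` single_crossings"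
      using K class_subset[of K] by (auto simp: single_crossings_def)
  qed (auto simp: single_crossings_def)
  then have "card single_crossings = card ?F"
    by (metis card_image inj_singleton)
  moreover have "card K + of_bool (card K = 1) = 2" if K: "K \<in> twist_classes D" for K
  proof -
    have "card K \<le> 2" using assms K by (simp add: t2_irreducible_def)
    moreover have "card K \<noteq> 0" using finite_class[OF K] class_nonempty[OF K] by simp
    ultimately show ?thesis by auto
  qed
  then have "(\<Sum>K\<in>twist_classes D. card K + of_bool (card K = 1)) = 2 * num_twist_classes D"
    by (simp add: num_twist_classes_def)
  then have "card (crossings D) + card ?F = 2 * num_twist_classes D"
    by (simp add: sum.distrib sum_classes Int_def)
  ultimately show ?thesis by simp
qed

lemma num_twist_classes_full:
  assumes "card full_classes = card (separating D) + 1"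
  shows "num_twist_classes D = card full_classes"
proof -
  have "K \<in> full_classes" if K: "K \<in> twist_classes D" for K
  proof -
    obtain c where c: "c \<in> K" using class_nonempty[OF K] by blast
    then have "c \<in> \<Union> full_classes" using card_full_eq[OF assms] class_subset[OF K] by blast
    then obtain K' where K': "K' \<in> full_classes" "c \<in> K'" by blast
    then have "K = K'" using classes_disjoint[OF K, of K'] c by (auto simp: full_classes_def)
    then show ?thesis using K' by simp
  qed
  then have "full_classes = twist_classes D" by (auto simp: full_classes_def)
  then show ?thesis by (simp add: num_twist_classes_def)
qed

text \<open>If no separating side were a bigon, a full class would meet non-separating circles only.
  Each of these has all its crossings on one side, so the class would be closed along circles and
  contain every crossing, including those on a separating circle.\<close>

lemma separating_bigon:
  assumes K: "K \<in> full_classes" and "separating D \<noteq> {}"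
  shows "{s \<in> separating_sides. card (part s) = 2} \<noteq> {}"
proof
  assume none: "{s \<in> separating_sides. card (part s) = 2} = {}"
  have Kc: "K \<in> twist_classes D" using K by (simp add: full_classes_def)
  have nonsep: "orbit (seifert_next D) p \<notin> separating D" if "p \<in> passages D" "fst p \<in> K" for p
  proof
    assume "orbit (seifert_next D) p \<in> separating D"
    then have "side_of p \<in> separating_sides"
      using side_of_in[OF that(1)] by (simp add: separating_sides_def side_of_def)
    moreover have "card (part (side_of p)) = 2" using K that by (simp add: full_classes_def)
    ultimately show False using none by blast
  qed
  have same: "fst q \<in> K" if "p \<in> passages D" "fst p \<in> K" "q \<in> orbit (seifert_next D) p" for p q
  proof -
    have "part (side_of p) = orbit (seifert_next D) p"
      using part_eq_circle[OF side_of_in[OF that(1)]] nonsep[OF that(1,2)] by (simp add: side_of_def)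
    then show ?thesis
      using side_closedD[OF full_class_closed[OF K] side_of_in[OF that(1)], of p q]
        in_part_side_of[OF that(1)] that by simp
  qed
  have "K = {} \<or> K = crossings D"
  proof (rule connected_circles[OF class_subset[OF Kc]])
    fix p assume p: "p \<in> passages D"
    have "p \<in> orbit (seifert_next D) (seifert_next D p)"
      using orbit_eq[OF finite_passages bij_seifert p orbit.base] circle_of[OF p] by simp
    then show "fst p \<in> K \<longleftrightarrow> fst (seifert_next D p) \<in> K"
      using same[OF p _ orbit.base] same[OF seifert_in[OF p], of p] by blast
  qed
  then have "K = crossings D" using class_nonempty[OF Kc] by simp
  moreover obtain C where C: "C \<in> separating D" using assms(2) by blast
  moreover from C have CC: "C \<in> circles D" by (simp add: separating_def)
  moreover obtain p where p: "p \<in> C" using circle_nonempty[OF CC] by blast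
  ultimately show False
    using nonsep[of p] circle_eq[OF CC p] circle_subset[OF CC] passages_fst by blast
qed

section \<open>The bounds\<close>

text \<open>Write d - 1 = (d - 3) + 2 for the degree d of each of the 2 J separating sides; d \<ge>
  2 keeps the subtraction on naturals exact.\<close>

lemma sum_separating_sides:
  "int (\<Sum>s\<in>separating_sides. card (part s) - 1) =
     (\<Sum>s\<in>separating_sides. int (card (part s)) - 3) + 4 * int (card (separating D))"
proof -
  have "int (card (part s) - 1) = (int (card (part s)) - 3) + 2" if "s \<in> separating_sides" for s
    using part_degree_ge[of s] that separating_sides_subset by (auto simp: of_nat_diff)
  then have "int (\<Sum>s\<in>separating_sides. card (part s) - 1) =
      (\<Sum>s\<in>separating_sides. (int (card (part s)) - 3) + 2)"
    unfolding of_nat_sum by (intro sum.cong) auto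
  also have "\<dots> = (\<Sum>s\<in>separating_sides. int (card (part s)) - 3) + (\<Sum>s\<in>separating_sides. 2)"
    by (rule sum.distrib)
  also have "(\<Sum>s\<in>separating_sides. 2) = 4 * int (card (separating D))"
    by (simp add: card_separating_sides)
  finally show ?thesis .
qed

text \<open>With J + 1 full classes all classes are full, so t = J + 1, and
  \<open>num_twist_classes_le\<close> gives J \<le> -\<chi>. Otherwise there are at most J full
  classes, and the term -3 J absorbs them.\<close>

lemma twist_class_bound:
  assumes "int (card (circles D)) \<le> int (card (crossings D))"
  shows "int (num_twist_classes D) \<le>
    (if card (circles D) < card (crossings D)
     then 3 * int (card (crossings D)) - 3 * int (card (circles D)) else 1)"
proof (cases "card full_classes = card (separating D) + 1")
  case True
  then have t: "int (num_twist_classes D) = int (card (separating D)) + 1"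
    using num_twist_classes_full by simp
  then have "int (card (separating D)) \<le> int (card (crossings D)) - int (card (circles D))"
    using num_twist_classes_le True by simp
  then have "int (num_twist_classes D) \<le> 3 * int (card (crossings D)) - 3 * int (card (circles D))"
    if "card (circles D) < card (crossings D)"
    using t that by linarith
  moreover have "int (num_twist_classes D) \<le> 1" if "\<not> card (circles D) < card (crossings D)"
    using t that \<open>int (card (separating D)) \<le> _\<close> by linarith
  ultimately show ?thesis by simp
next
  case False
  then show ?thesis using card_full_le num_twist_classes_le assms by auto
qed

lemma components_nonempty: "card components \<ge> 1"
proof -
  have "passages D \<noteq> {}" using crossings_nonempty by (auto simp: passages_def)
  then have "components \<noteq> {}" by (simp add: components_def)
  then show ?thesis by (simp add: Suc_le_eq card_gt_0_iff)
qed

text \<open>The counts of degrees, bigons and components are combined linearly. The cases follow the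
  number e of full classes, the number w of single crossings and the number J of separating
  circles.\<close>

lemma crossing_bound:
  assumes irr: "t2_irreducible D" and neg: "card (circles D) < card (crossings D)"
  defines "\<chi> \<equiv> int (card (circles D)) - int (card (crossings D))"
    and "n \<equiv> int (card components)"
  shows "int (card (crossings D)) \<le> -5 * \<chi> + n - 3 \<or>
    int (card (crossings D)) \<le> -6 * \<chi> \<and> n \<ge> 2 - \<chi> \<or>
    int (card (crossings D)) \<le> 4 \<and> \<chi> = -1 \<and> n = 1"
proof -
  define c where "c = int (card (crossings D))"
  define s where "s = int (card (circles D))"
  define J where "J = int (card (separating D))"
  define e where "e = int (card full_classes)"
  define t where "t = int (num_twist_classes D)"
  define w where "w = int (card single_crossings)"
  define b where "b = int (card {s \<in> separating_sides. card (part s) = 2})"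
  define b' where "b' = int (card {s \<in> sides D - separating_sides. card (part s) = 2})"
  define x where "x = (\<Sum>s\<in>separating_sides. int (card (part s)) - 3)"
  define z where "z = (\<Sum>s\<in>sides D - separating_sides. int (card (part s)) - 3)"
  have chi: "\<chi> = s - c" "\<chi> < 0" using neg by (simp_all add: \<chi>_def s_def c_def)
  have n: "n \<ge> 1" using components_nonempty by (simp add: n_def)
  have xz: "x + z = 2 * c - 3 * s - 3 * J"
    using sum_excess sum.subset_diff[OF separating_sides_subset finite_sides,
        of "\<lambda>s. int (card (part s)) - 3"]
    unfolding x_def z_def c_def s_def J_def by linarith
  have xb: "x \<ge> - b" using sum_excess_ge[OF separating_sides_subset] by (simp add: x_def b_def)
  have zb: "z \<ge> - b'" using sum_excess_ge[of "sides D - separating_sides"]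
    by (simp add: z_def b'_def)
  have bb: "b + b' = int (card {s \<in> sides D. card (part s) = 2})"
  proof -
    have "{s \<in> sides D. card (part s) = 2} = {s \<in> separating_sides. card (part s) = 2} \<union>
        {s \<in> sides D - separating_sides. card (part s) = 2}"
      using separating_sides_subset by blast
    moreover have "card \<dots> = card {s \<in> separating_sides. card (part s) = 2} +
        card {s \<in> sides D - separating_sides. card (part s) = 2}"
      using finite_subset[OF separating_sides_subset] by (intro card_Un_disjoint) auto
    ultimately show ?thesis by (simp add: b_def b'_def)
  qed
  have big: "b + b' + t \<le> c + e" using card_bigons_le by (simp add: bb t_def c_def e_def)
  have cw: "c + w = 2 * t" using card_single_crossings[OF irr] by (simp add: c_def w_def t_def flip: of_nat_add)
  have te: "t \<le> 3 * c - 3 * s - 3 * J + e"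
    using num_twist_classes_le by (simp add: t_def c_def s_def J_def e_def)
  have eJ: "e \<le> J + 1" using card_full_le by (simp add: e_def J_def)
  have full: "t = e" if "e = J + 1"
    using num_twist_classes_full that by (simp add: t_def e_def J_def)
  have comps: "c + 2 \<le> s + int (card single_crossings - 1) + x + 4 * J + n"
    using card_components_ge[OF irr] sum_separating_sides
    unfolding c_def s_def x_def J_def n_def by linarith
  have pos: "b \<ge> 0" "b' \<ge> 0" "J \<ge> 0" "e \<ge> 0" "w \<ge> 0"
    by (simp_all add: b_def b'_def J_def e_def w_def)
  have b1: "b \<ge> 1" if "e \<ge> 1" "J \<ge> 1"
  proof -
    have "full_classes \<noteq> {}" "separating D \<noteq> {}" using that by (auto simp: e_def J_def)
    then have "{s \<in> separating_sides. card (part s) = 2} \<noteq> {}" using separating_bigon by blast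
    then show ?thesis using finite_subset[OF separating_sides_subset]
      by (simp add: b_def Suc_le_eq card_gt_0_iff)
  qed
  have "c \<le> -5 * \<chi> + n - 3 \<or> c \<le> -6 * \<chi> \<and> n \<ge> 2 - \<chi> \<or> c \<le> 4 \<and> \<chi> = -1 \<and> n = 1"
  proof (cases "e = J + 1")
    case True
    \<comment> \<open>All classes are full, so t = J + 1 and c \<le> 2 t. The resulting bound 2 - 2
      \<chi> exceeds -5 \<chi> + n - 3 only for \<chi> = -1 and n = 1.\<close>
    then have "c \<le> 2 * J + 2" "\<chi> \<le> - J" using full cw te pos chi by linarith+
    then show ?thesis using n chi(2) pos by (cases "\<chi> = -1") (cases "n = 1"; linarith)+
  next
    case False
    then have eJ': "e \<le> J" using eJ by linarith
    show ?thesis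
    proof (cases "w = 0")
      case False
      then have "int (card single_crossings - 1) = w - 1" using pos by (simp add: w_def)
      \<comment> \<open>Omitting one single crossing from the constraints gains one; the combined
        inequalities then leave the slack b + 2 (J - e) \<ge> 0.\<close>
      then have "c \<le> -5 * \<chi> + n - 3" using comps xz xb zb big cw eJ' pos chi by linarith
      then show ?thesis by simp
    next
      case True
      then have 0: "int (card single_crossings - 1) = 0" by (simp add: w_def)
      show ?thesis
      proof (cases "J = 0")
        case True
        \<comment> \<open>With neither single crossings nor separating circles there are no
          constraints, which forces n \<ge> 2 - \<chi>; moreover c = 2 t and t \<le> -3
          \<chi>.\<close>
        then have "separating_sides = {}"
          using card_separating_sides finite_subset[OF separating_sides_subset] by (simp add: J_def)
        then have "x = 0" by (simp add: x_def)
        then have "c \<le> -6 * \<chi> \<and> n \<ge> 2 - \<chi>"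
          using comps 0 True te cw eJ' pos chi \<open>w = 0\<close> by linarith
        then show ?thesis by simp
      next
        case False
        \<comment> \<open>For w = 0 no single crossing can be omitted, so the slack has to be at
          least 1. This comes from e < J or, if e = J \<ge> 1, from the bigon of
          \<open>separating_bigon\<close>.\<close>
        then have "1 \<le> b - 2 * e + 2 * J" using b1 eJ' pos by linarith
        then have "c \<le> -5 * \<chi> + n - 3"
          using comps 0 xz xb zb big cw pos chi \<open>w = 0\<close> by linarith
        then show ?thesis by simp
      qed
    qed
  qed
  then show ?thesis by (simp only: c_def)
qed

end

section \<open>From link diagrams to the locale, and the final case distinction\<close>

lemma reduced_diagramI:
  fixes D :: "'c diagram"
  assumes D: "link_diagram D" "reduced D" "connected_diagram D" and "canonical_euler_char D \<le> 0"
  shows "reduced_diagram D" and "simple_circles D = 0"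
proof -
  let ?A = "(adjacent_crossings D \<union> (adjacent_crossings D)\<inverse>)\<^sup>*"
  let ?R = "{(c, c'). c \<in> crossings D \<and> c' \<in> crossings D \<and> (c, c') \<in> ?A}"
  have fin: "finite (crossings D)" and perm: "next_passage D permutes passages D"
    using D(1) by (simp_all add: link_diagram_def)
  \<comment> \<open>Without crossings, connectedness leaves one simple circle, whose Euler
    characteristic is 1.\<close>
  have ne: "crossings D \<noteq> {}"
  proof
    assume empty: "crossings D = {}"
    then have "simple_circles D = 1" "passages D = {}"
      using D(3) by (simp_all add: connected_diagram_def pieces_def passages_def)
    then show False using assms(4) empty
      by (simp add: canonical_euler_char_def num_seifert_circles_def crossing_number_def)
  qed
  have "finite (pieces D)" unfolding pieces_def by (rule finite_quotient[OF fin]) auto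
  moreover have "pieces D \<noteq> {}" using ne by (simp add: pieces_def quotient_is_empty)
  ultimately have "card (pieces D) \<ge> 1" by (simp add: Suc_le_eq card_gt_0_iff)
  then have pieces: "card (pieces D) = 1" and simple: "simple_circles D = 0"
    using D(3) by (simp_all add: connected_diagram_def)
  show "simple_circles D = 0" by (rule simple)
  show "reduced_diagram D"
  proof
    show "card (regions D) = card (crossings D) + 2"
      using D(1) pieces by (simp add: link_diagram_def)
    fix c assume c: "c \<in> crossings D"
    let ?h = "((c, rightward D c), Outgoing)"
    \<comment> \<open>Two rotations lead from the corner between the outgoing ends to the opposite
      one, between the incoming ends.\<close>
    have "region D ?h \<noteq> region D (rot D (rot D ?h))"
      using D(2) c unfolding reduced_def nugatory_def ends_at_def by fast
    then show "top_region D c \<noteq> bottom_region D c"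
      by (simp add: top_region_def bottom_region_def)
  next
    fix Z assume Z: "Z \<subseteq> crossings D"
      and closed: "\<And>p. p \<in> passages D \<Longrightarrow> fst p \<in> Z \<longleftrightarrow> fst (next_passage D p) \<in> Z"
    have adj: "c \<in> Z \<longleftrightarrow> c' \<in> Z" if "(c, c') \<in> ?A" for c c'
      using that
    proof induction
      case (step c' c'')
      have "c' \<in> Z \<longleftrightarrow> c'' \<in> Z"
        using step.hyps(2) closed by (auto simp: adjacent_crossings_def)
      then show ?case using step.IH by simp
    qed simp
    obtain P where P: "pieces D = {P}" using pieces by (rule card_1_singletonE)
    have "c' \<in> Z" if "c \<in> Z" "c' \<in> crossings D" for c c'
    proof -
      have "?R `` {c} \<in> pieces D" "?R `` {c'} \<in> pieces D"
        unfolding pieces_def by (rule quotientI, use that Z in blast)+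
      then have "?R `` {c} = ?R `` {c'}" using P by simp
      moreover have "c' \<in> ?R `` {c'}" using that by simp
      ultimately have "(c, c') \<in> ?A" by blast
      then show ?thesis using adj that(1) by blast
    qed
    then show "Z = {} \<or> Z = crossings D" using Z by blast
  qed (use fin perm ne in auto)
qed

theorem theorem3p1:
  fixes D :: "'c diagram"
  assumes "link_diagram D" and "reduced D" and "connected_diagram D"
    and "canonical_euler_char D \<le> 0"
  shows "int (num_twist_classes D) \<le>
           (if canonical_euler_char D < 0 then - 3 * canonical_euler_char D else 1) \<and>
         (t2_irreducible D \<longrightarrow>
           int (crossing_number D) \<le>
           (if canonical_euler_char D = - 1 \<and> num_components D = 1 then 4
            else if canonical_euler_char D = 0 then 2
            else if canonical_euler_char D < 0 \<and>
                    int (num_components D) = 2 - canonical_euler_char D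
              then - 6 * canonical_euler_char D
            else - 5 * canonical_euler_char D + int (num_components D) - 3))"
proof -
  interpret reduced_diagram D by (rule reduced_diagramI(1)[OF assms])
  have chi: "canonical_euler_char D = int (card (circles D)) - int (card (crossings D))"
    and comps: "num_components D = card components"
    and cn: "crossing_number D = card (crossings D)"
    using reduced_diagramI(2)[OF assms]
    by (simp_all add: canonical_euler_char_def num_seifert_circles_def crossing_number_def
        num_components_def circles_def components_def)
  have bound: "int (num_twist_classes D) \<le>
      (if canonical_euler_char D < 0 then - 3 * canonical_euler_char D else 1)"
    using twist_class_bound assms(4) by (auto simp: chi split: if_splits)
  have "int (crossing_number D) \<le>
           (if canonical_euler_char D = - 1 \<and> num_components D = 1 then 4
            else if canonical_euler_char D = 0 then 2
            else if canonical_euler_char D < 0 \<and>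
                    int (num_components D) = 2 - canonical_euler_char D
              then - 6 * canonical_euler_char D
            else - 5 * canonical_euler_char D + int (num_components D) - 3)"
    if irr: "t2_irreducible D"
  proof (cases "canonical_euler_char D = 0")
    case True
    then show ?thesis using bound card_single_crossings[OF irr] by (simp add: cn)
  next
    case False
    then have "canonical_euler_char D < 0" using assms(4) by simp
    then have "card (circles D) < card (crossings D)" by (simp add: chi)
    \<comment> \<open>The alternatives fit the cases: for n = 2 - \<chi> the first bound is -6
      \<chi> - 1, for larger n it is at least -6 \<chi>, and for \<chi> = -1 and n = 1 it is
      3.\<close>
    then show ?thesis using crossing_bound[OF irr] \<open>canonical_euler_char D < 0\<close>
      unfolding comps cn by (auto simp flip: chi)
  qed
  then show ?thesis using bound by blast
qed

end
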